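(* Consider the linear system $$\frac{\partial^2 z}{\partial x^2}=\frac{4k_1(k_1y+k_2)}{(4x+k_3)^2}\frac{\partial z}{\partial y},\qquad \frac{\partial^2 z}{\partial y^2}=\frac{4x+k_3}{(k_1y+k_2)^2}\frac{\partial z}{\partial x},$$ with $k_1,k_2,k_3\in\mathbb K$. Then this system is of rank 4 (its local solution space is 4-dimensional), and hence the solutions define a 3-parameter family of projectively applicable surfaces $\Sigma=\Sigma_{k_1,k_2,k_3}\subset\mathbb P^3$ with $(x,y)$ as asymptotic coordinates.
   Context: $\mathbb K$ is $\mathbb R$ or $\mathbb C$ (smooth, resp. holomorphic category); the system is considered locally where its coefficients are defined, i.e. $4x+k_3\ne0$ and $k_1y+k_2\neq0$. A rank-4 system of the form $z_{xx}=bz_y+\mu z$, $z_{yy}=cz_x+\nu z$ defines an immersed surface $\Sigma\subset\mathbb P^3$ by $(x,y)\mapsto[z_0:z_1:z_2:z_3]$, with $z_0,\dots,z_3$ a basis of solutions. The surface is well defined up to projective transformation, and its projective second fundamental form is conformal to $dx\otimes dy+dy\otimes dx$. Coordinates are asymptotic if their coordinate curves are null for the projective second fundamental form. A map $F:\Sigma\to\Sigma'$ of surfaces in $\mathbb P^3$ is a projective deformation if for all $p\in\Sigma$ there is a projective transformation $g_p\in\mathrm{PSL}(4)$ with $g_p(p)=F(p)$ such that, for every smooth curve $C\subset\Sigma$ through $p$, $g_p(C)$ has second order contact at $F(p)$ with $F(C)$. A surface is projectively applicable if it possesses a nontrivial projective deformation. Equivalently, in common asymptotic coordinates, the canonical systems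 of the two surfaces have the same $b$ and $c$. *)

theory Defs
  imports "HOL-Analysis.Analysis" "HOL-Library.Function_Algebras"
begin

text \<open>
  Everything is polymorphic in the ground field \<open>'k\<close>, which is meant to be \<^typ>\<open>real\<close> or
  \<^typ>\<open>complex\<close>; \<^const>\<open>deriv\<close> and \<^const>\<open>field_differentiable\<close> are taken over \<open>'k\<close>, so that
  smooth means \<open>C\<^sup>\<infinity>\<close> over the reals and holomorphic over the complex numbers.
  The coordinate plane is \<open>'k \<times> 'k\<close>.
\<close>

section \<open>Smoothness\<close>

definition pdx :: "('k \<times> 'k \<Rightarrow> 'k::real_normed_field) \<Rightarrow> 'k \<times> 'k \<Rightarrow> 'k" where
  "pdx f = (\<lambda>(x, y). deriv (\<lambda>s. f (s, y)) x)"

definition pdy :: "('k \<times> 'k \<Rightarrow> 'k::real_normed_field) \<Rightarrow> 'k \<times> 'k \<Rightarrow> 'k" where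
  "pdy f = (\<lambda>(x, y). deriv (\<lambda>t. f (x, t)) y)"

primrec times_cont_diff_on :: "nat \<Rightarrow> ('k \<times> 'k) set \<Rightarrow> ('k \<times> 'k \<Rightarrow> 'k::real_normed_field) \<Rightarrow> bool" where
  "times_cont_diff_on 0 U f \<longleftrightarrow> continuous_on U f"
| "times_cont_diff_on (Suc n) U f \<longleftrightarrow>
     continuous_on U f \<and>
     (\<forall>(x, y) \<in> U. (\<lambda>s. f (s, y)) field_differentiable (at x) \<and>
                    (\<lambda>t. f (x, t)) field_differentiable (at y)) \<and>
     times_cont_diff_on n U (pdx f) \<and> times_cont_diff_on n U (pdy f)"

text \<open>Only used for open \<open>U\<close>.\<close>

definition smooth2_on :: "('k \<times> 'k) set \<Rightarrow> ('k \<times> 'k \<Rightarrow> 'k::real_normed_field) \<Rightarrow> bool" where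
  "smooth2_on U f \<longleftrightarrow> (\<forall>n. times_cont_diff_on n U f)"

definition smooth1_on :: "'k set \<Rightarrow> ('k \<Rightarrow> 'k::real_normed_field) \<Rightarrow> bool" where
  "smooth1_on S f \<longleftrightarrow> (\<forall>n. \<forall>t\<in>S. (deriv ^^ n) f field_differentiable (at t))"

section \<open>Linear systems and their solution spaces\<close>

definition fscale :: "'k::field \<Rightarrow> ('a \<Rightarrow> 'k) \<Rightarrow> 'a \<Rightarrow> 'k" where
  "fscale a f = (\<lambda>p. a * f p)"

lemma vector_space_fscale: "vector_space (fscale :: 'k::field \<Rightarrow> ('a \<Rightarrow> 'k) \<Rightarrow> 'a \<Rightarrow> 'k)"
  by unfold_locales (auto simp: fscale_def fun_eq_iff algebra_simps)

text \<open>
  Solutions on \<open>U\<close> of \<open>z\<^sub>x\<^sub>x = b z\<^sub>y + \<mu> z\<close>, \<open>z\<^sub>y\<^sub>y = c z\<^sub>x + \<nu> z\<close>.  Functions are total, so a function on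
  \<open>U\<close> is represented by its extension by \<open>0\<close>; this makes the set below a vector space isomorphic
  to the space of solutions on \<open>U\<close>.
\<close>

definition solution_space ::
  "('k \<times> 'k \<Rightarrow> 'k) \<Rightarrow> ('k \<times> 'k \<Rightarrow> 'k) \<Rightarrow> ('k \<times> 'k \<Rightarrow> 'k) \<Rightarrow> ('k \<times> 'k \<Rightarrow> 'k) \<Rightarrow>
   ('k \<times> 'k) set \<Rightarrow> ('k \<times> 'k \<Rightarrow> 'k::real_normed_field) set" where
  "solution_space b \<mu> c \<nu> U =
     {z. smooth2_on U z \<and> (\<forall>p. p \<notin> U \<longrightarrow> z p = 0) \<and>
         (\<forall>p\<in>U. pdx (pdx z) p = b p * pdy z p + \<mu> p * z p \<and>
                pdy (pdy z) p = c p * pdx z p + \<nu> p * z p)}"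

definition is_basis4 :: "(4 \<Rightarrow> 'a \<Rightarrow> 'k::field) \<Rightarrow> ('a \<Rightarrow> 'k) set \<Rightarrow> bool" where
  "is_basis4 z V \<longleftrightarrow>
     inj z \<and> \<not> module.dependent fscale (range z) \<and> module.span fscale (range z) = V"

section \<open>Surfaces in projective 3-space\<close>

text \<open>A point \<open>[v]\<close> of projective 3-space is the line through \<open>v \<noteq> 0\<close> with the origin removed.\<close>

definition pt :: "'k::field ^ 4 \<Rightarrow> ('k ^ 4) set" where
  "pt v = {a *s v | a. a \<noteq> 0}"

definition proj_act :: "'k::field ^ 4 ^ 4 \<Rightarrow> ('k ^ 4) set \<Rightarrow> ('k ^ 4) set" where
  "proj_act g P = (\<lambda>v. g *v v) ` P"

definition map_of_functions :: "(4 \<Rightarrow> 'a \<Rightarrow> 'k::field) \<Rightarrow> 'a \<Rightarrow> ('k ^ 4) set" where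
  "map_of_functions z p = pt (\<chi> i. z i p)"

definition vdx :: "('k \<times> 'k \<Rightarrow> 'k::real_normed_field ^ 4) \<Rightarrow> 'k \<times> 'k \<Rightarrow> 'k ^ 4" where
  "vdx w q = (\<chi> i. pdx (\<lambda>r. w r $ i) q)"

definition vdy :: "('k \<times> 'k \<Rightarrow> 'k::real_normed_field ^ 4) \<Rightarrow> 'k \<times> 'k \<Rightarrow> 'k ^ 4" where
  "vdy w q = (\<chi> i. pdy (\<lambda>r. w r $ i) q)"

definition local_lift ::
  "('k \<times> 'k \<Rightarrow> ('k ^ 4) set) \<Rightarrow> ('k \<times> 'k) set \<Rightarrow> ('k \<times> 'k \<Rightarrow> 'k::real_normed_field ^ 4) \<Rightarrow> bool" where
  "local_lift \<phi> N w \<longleftrightarrow>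
     open N \<and> (\<forall>i. smooth2_on N (\<lambda>q. w q $ i)) \<and> (\<forall>q\<in>N. w q \<noteq> 0 \<and> \<phi> q = pt (w q))"

text \<open>
  An immersed surface is given by a parametrisation \<open>\<phi>\<close> on an open set \<open>U\<close> of the coordinate plane.
  Being an immersion into projective space means that \<open>w, w\<^sub>x, w\<^sub>y\<close> are linearly independent
  for a local lift \<open>w\<close> (this does not depend on the lift).
\<close>

definition immersed_surface ::
  "('k \<times> 'k) set \<Rightarrow> ('k \<times> 'k \<Rightarrow> ('k::real_normed_field ^ 4) set) \<Rightarrow> bool" where
  "immersed_surface U \<phi> \<longleftrightarrow> open U \<and> U \<noteq> {} \<and>
     (\<forall>p\<in>U. \<exists>N w. p \<in> N \<and> N \<subseteq> U \<and> local_lift \<phi> N w \<and>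
        (\<forall>q\<in>N. \<forall>a b c. a *s w q + b *s vdx w q + c *s vdy w q = 0 \<longrightarrow> a = 0 \<and> b = 0 \<and> c = 0))"

text \<open>
  The projective second fundamental form sends \<open>X, Y\<close> to the class of the second derivative of a
  lift \<open>w\<close> along \<open>X, Y\<close> modulo the span of \<open>w, w\<^sub>x, w\<^sub>y\<close>.  The determinant with \<open>w, w\<^sub>x, w\<^sub>y\<close>
  identifies this quotient with \<open>'k\<close>.  Replacing \<open>w\<close> by \<open>\<lambda>w\<close> multiplies the
  form by \<open>\<lambda>\<^sup>4\<close>, so its conformal class, and hence nullity, depend on the surface only.
\<close>

definition second_ff ::
  "('k \<times> 'k \<Rightarrow> 'k::real_normed_field ^ 4) \<Rightarrow> 'k \<times> 'k \<Rightarrow> 'k \<times> 'k \<Rightarrow> 'k \<times> 'k \<Rightarrow> 'k" where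
  "second_ff w p X Y =
     det (vector [w p, vdx w p, vdy w p,
        (fst X * fst Y) *s vdx (vdx w) p
        + (fst X * snd Y + snd X * fst Y) *s vdy (vdx w) p
        + (snd X * snd Y) *s vdy (vdy w) p] :: 'k ^ 4 ^ 4)"

definition asymptotic_coordinates ::
  "('k \<times> 'k) set \<Rightarrow> ('k \<times> 'k \<Rightarrow> ('k::real_normed_field ^ 4) set) \<Rightarrow> bool" where
  "asymptotic_coordinates U \<phi> \<longleftrightarrow>
     (\<forall>p\<in>U. \<exists>N w. p \<in> N \<and> local_lift \<phi> N w \<and>
        second_ff w p (1, 0) (1, 0) = 0 \<and> second_ff w p (0, 1) (0, 1) = 0)"

definition second_ff_conformal_dxdy ::
  "('k \<times> 'k) set \<Rightarrow> ('k \<times> 'k \<Rightarrow> ('k::real_normed_field ^ 4) set) \<Rightarrow> bool" where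
  "second_ff_conformal_dxdy U \<phi> \<longleftrightarrow>
     (\<forall>p\<in>U. \<exists>N w. p \<in> N \<and> local_lift \<phi> N w \<and>
        (\<exists>\<rho>. \<rho> \<noteq> 0 \<and> (\<forall>X Y. second_ff w p X Y = \<rho> * (fst X * snd Y + snd X * fst Y))))"

section \<open>Projective deformations\<close>

definition curve_through ::
  "('k \<times> 'k) set \<Rightarrow> 'k \<times> 'k \<Rightarrow> ('k::real_normed_field \<Rightarrow> 'k \<times> 'k) \<Rightarrow> bool" where
  "curve_through U p \<gamma> \<longleftrightarrow> \<gamma> 0 = p \<and>
     (\<exists>S. open S \<and> 0 \<in> S \<and> \<gamma> ` S \<subseteq> U \<and>
        smooth1_on S (\<lambda>t. fst (\<gamma> t)) \<and> smooth1_on S (\<lambda>t. snd (\<gamma> t))) \<and>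
     (deriv (\<lambda>t. fst (\<gamma> t)) 0, deriv (\<lambda>t. snd (\<gamma> t)) 0) \<noteq> (0, 0)"

text \<open>
  Second order contact, at parameter value \<open>0\<close>, of the unparametrised curves traced by \<open>\<alpha>\<close> and \<open>\<beta>\<close>:
  after a change \<open>\<tau>\<close> of the parameter of one of them, the two curves have lifts with the same
  2-jet, i.e. the same 2-jet as curves in projective space.
\<close>

definition second_order_contact ::
  "('k::real_normed_field \<Rightarrow> ('k ^ 4) set) \<Rightarrow> ('k \<Rightarrow> ('k ^ 4) set) \<Rightarrow> bool" where
  "second_order_contact \<alpha> \<beta> \<longleftrightarrow>
     (\<exists>S \<tau> u v. open S \<and> 0 \<in> S \<and>
        smooth1_on S \<tau> \<and> \<tau> 0 = 0 \<and> deriv \<tau> 0 \<noteq> 0 \<and>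
        (\<forall>i. smooth1_on S (\<lambda>t. u t $ i)) \<and> (\<forall>i. smooth1_on S (\<lambda>t. v t $ i)) \<and>
        (\<forall>t\<in>S. u t \<noteq> 0 \<and> \<alpha> (\<tau> t) = pt (u t)) \<and>
        (\<forall>t\<in>S. v t \<noteq> 0 \<and> \<beta> t = pt (v t)) \<and>
        (\<forall>k\<le>2. \<forall>i. (deriv ^^ k) (\<lambda>t. u t $ i) 0 = (deriv ^^ k) (\<lambda>t. v t $ i) 0))"

text \<open>
  Maps between immersed surfaces are maps between their parameter domains.  Elements of \<open>PSL(4)\<close>
  are given by matrices of determinant \<open>1\<close>.
\<close>

definition projective_deformation ::
  "('k \<times> 'k) set \<Rightarrow> ('k \<times> 'k \<Rightarrow> ('k::real_normed_field ^ 4) set) \<Rightarrow>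
   ('k \<times> 'k) set \<Rightarrow> ('k \<times> 'k \<Rightarrow> ('k ^ 4) set) \<Rightarrow> ('k \<times> 'k \<Rightarrow> 'k \<times> 'k) \<Rightarrow> bool" where
  "projective_deformation U \<phi> V \<psi> F \<longleftrightarrow>
     F ` U \<subseteq> V \<and> smooth2_on U (\<lambda>p. fst (F p)) \<and> smooth2_on U (\<lambda>p. snd (F p)) \<and>
     (\<forall>p\<in>U. \<exists>g :: 'k ^ 4 ^ 4. det g = 1 \<and> proj_act g (\<phi> p) = \<psi> (F p) \<and>
        (\<forall>\<gamma>. curve_through U p \<gamma> \<longrightarrow>
             second_order_contact (\<lambda>t. proj_act g (\<phi> (\<gamma> t))) (\<lambda>t. \<psi> (F (\<gamma> t)))))"

text \<open>
  A deformation is trivial if it is the restriction of one projective transformation.  All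
  invertible matrices are allowed here: over the reals, transformations of negative
  determinant are to count as trivial as well.
\<close>

definition trivial_deformation ::
  "('k \<times> 'k) set \<Rightarrow> ('k \<times> 'k \<Rightarrow> ('k::real_normed_field ^ 4) set) \<Rightarrow>
   ('k \<times> 'k \<Rightarrow> ('k ^ 4) set) \<Rightarrow> ('k \<times> 'k \<Rightarrow> 'k \<times> 'k) \<Rightarrow> bool" where
  "trivial_deformation U \<phi> \<psi> F \<longleftrightarrow>
     (\<exists>g :: 'k ^ 4 ^ 4. invertible g \<and> (\<forall>p\<in>U. \<psi> (F p) = proj_act g (\<phi> p)))"

definition projectively_applicable ::
  "('k \<times> 'k) set \<Rightarrow> ('k \<times> 'k \<Rightarrow> ('k::real_normed_field ^ 4) set) \<Rightarrow> bool" where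
  "projectively_applicable U \<phi> \<longleftrightarrow> immersed_surface U \<phi> \<and>
     (\<exists>V \<psi> F. immersed_surface V \<psi> \<and> projective_deformation U \<phi> V \<psi> F \<and>
              \<not> trivial_deformation U \<phi> \<psi> F)"

section \<open>The family of systems\<close>

definition coeff_b :: "'k::field \<Rightarrow> 'k \<Rightarrow> 'k \<Rightarrow> 'k \<times> 'k \<Rightarrow> 'k" where
  "coeff_b k1 k2 k3 = (\<lambda>(x, y). 4 * k1 * (k1 * y + k2) / (4 * x + k3)^2)"

definition coeff_c :: "'k::field \<Rightarrow> 'k \<Rightarrow> 'k \<Rightarrow> 'k \<times> 'k \<Rightarrow> 'k" where
  "coeff_c k1 k2 k3 = (\<lambda>(x, y). (4 * x + k3) / (k1 * y + k2)^2)"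

definition coeff_domain :: "'k::field \<Rightarrow> 'k \<Rightarrow> 'k \<Rightarrow> ('k \<times> 'k) set" where
  "coeff_domain k1 k2 k3 = {(x, y). 4 * x + k3 \<noteq> 0 \<and> k1 * y + k2 \<noteq> 0}"

definition family_solutions ::
  "'k \<Rightarrow> 'k \<Rightarrow> 'k \<Rightarrow> ('k \<times> 'k) set \<Rightarrow> ('k \<times> 'k \<Rightarrow> 'k::real_normed_field) set" where
  "family_solutions k1 k2 k3 U =
     solution_space (coeff_b k1 k2 k3) (\<lambda>_. 0) (coeff_c k1 k2 k3) (\<lambda>_. 0) U"

end

theory Submission
  imports Defs "HOL-Complex_Analysis.Cauchy_Integral_Theorem"
begin

text \<open>
  Write \<open>X = 4x + k\<^sub>3\<close>, \<open>Y = k\<^sub>1y + k\<^sub>2\<close>.  Differentiating \<open>z\<^sub>x\<^sub>x = b z\<^sub>y\<close> by \<open>y\<close> and \<open>z\<^sub>y\<^sub>y = c z\<^sub>x\<close> by \<open>x\<close> shows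
  that the frame \<open>(z, z\<^sub>x, z\<^sub>y, z\<^sub>x\<^sub>y)\<close> of a solution satisfies a linear first order system with trace-free
  coefficient matrices.  On a convex domain a solution is therefore determined by its frame at one point
  (\<open>solution_unique\<close>), so the rank is at most 4, and the Wronskian determinant of four solutions is
  constant (\<open>det_wronskian_constant\<close>).  That the rank is exactly 4 is seen from explicit solutions: with
  primitives \<open>A\<close> of \<open>1/X\<close> and \<open>B\<close> of \<open>1/Y\<close>, these are \<open>1\<close>, \<open>k\<^sub>1A - B\<close> and \<open>exp (P A + r B)\<close> for
  \<open>(P, r) = (4 \<plusminus> 2k\<^sub>1, k\<^sub>1 \<plusminus> 2)\<close>; if \<open>k\<^sub>1 = \<plusminus>2\<close> one exponential degenerates to a constant and
  \<open>(k\<^sub>1A - B)\<^sup>2 + 2A\<close> replaces it (\<open>family_fundamental_system\<close>).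

  The Wronskian of a basis vanishes nowhere, so \<open>z, z\<^sub>x, z\<^sub>y\<close> give an immersion; as the system expresses
  \<open>z\<^sub>x\<^sub>x\<close> and \<open>z\<^sub>y\<^sub>y\<close> by \<open>z, z\<^sub>x, z\<^sub>y\<close>, only \<open>z\<^sub>x\<^sub>y\<close> contributes to the second fundamental form, which is a
  multiple of \<open>dx dy\<close> (\<open>second_ff_solutions\<close>).

  For applicability, the same \<open>b\<close> and \<open>c\<close> admit potentials: \<open>z\<^sub>x\<^sub>x = b z\<^sub>y + \<alpha>/X\<^sup>2 z\<close>, \<open>z\<^sub>y\<^sub>y = c z\<^sub>x + \<beta>/Y\<^sup>2 z\<close> has
  rank 4 as well.  At each point the matrix that carries one frame to the other, together with a
  quadratic rescaling along the curve, produces second order contact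
  (\<open>projective_deformation_of_same_bc\<close>).  A trivial deformation would force \<open>\<alpha> = \<beta> = 0\<close>
  (\<open>trivial_deformation_potentials_vanish\<close>), so it remains to choose \<open>\<alpha>\<close> and \<open>\<beta> \<noteq> 0\<close> such that the
  deformed system has four independent exponential solutions over the ground field
  (\<open>deformed_exponents\<close>).

  Everything but the existence of \<open>A\<close> and \<open>B\<close> is uniform in the ground field.
\<close>

section \<open>Calculus of functions of two variables\<close>

text \<open>Continuity is included so that this is exactly one step of the recursion of
  \<open>times_cont_diff_on\<close>.\<close>

definition has_partials_on ::
  "('k::real_normed_field \<times> 'k) set \<Rightarrow> ('k \<times> 'k \<Rightarrow> 'k) \<Rightarrow> ('k \<times> 'k \<Rightarrow> 'k) \<Rightarrow> ('k \<times> 'k \<Rightarrow> 'k) \<Rightarrow> bool"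
  where
  "has_partials_on U f fx fy \<longleftrightarrow> continuous_on U f \<and>
     (\<forall>x y. (x, y) \<in> U \<longrightarrow> ((\<lambda>s. f (s, y)) has_field_derivative fx (x, y)) (at x) \<and>
                         ((\<lambda>t. f (x, t)) has_field_derivative fy (x, y)) (at y))"

lemma has_partials_on_pdx: "has_partials_on U f fx fy \<Longrightarrow> p \<in> U \<Longrightarrow> pdx f p = fx p"
  by (cases p) (auto simp: has_partials_on_def pdx_def intro: DERIV_imp_deriv)

lemma has_partials_on_pdy: "has_partials_on U f fx fy \<Longrightarrow> p \<in> U \<Longrightarrow> pdy f p = fy p"
  by (cases p) (auto simp: has_partials_on_def pdy_def intro: DERIV_imp_deriv)

lemma has_partials_on_add:
  assumes "has_partials_on U f fx fy" "has_partials_on U g gx gy"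
  shows "has_partials_on U (\<lambda>p. f p + g p) (\<lambda>p. fx p + gx p) (\<lambda>p. fy p + gy p)"
  using assms unfolding has_partials_on_def by (auto intro!: continuous_on_add DERIV_add)

lemma has_partials_on_mult:
  assumes "has_partials_on U f fx fy" "has_partials_on U g gx gy"
  shows "has_partials_on U (\<lambda>p. f p * g p) (\<lambda>p. fx p * g p + f p * gx p) (\<lambda>p. fy p * g p + f p * gy p)"
  using assms unfolding has_partials_on_def
  by (auto intro!: continuous_on_mult derivative_eq_intros)

lemma has_partials_on_const: "has_partials_on U (\<lambda>_. a) (\<lambda>_. 0) (\<lambda>_. 0)"
  by (auto simp: has_partials_on_def)

lemma pdx_cong:
  assumes "open U" "p \<in> U" "\<And>q. q \<in> U \<Longrightarrow> f q = g q"
  shows "pdx f p = pdx g p"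
proof (cases p)
  case (Pair x y)
  have "open ((\<lambda>s. (s, y)) -` U)"
    by (intro open_vimage assms(1) continuous_intros)
  then have "\<forall>\<^sub>F s in nhds x. f (s, y) = g (s, y)"
    using assms(2,3) Pair by (auto simp: eventually_nhds)
  then show ?thesis by (simp add: Pair pdx_def deriv_cong_ev)
qed

lemma pdy_cong:
  assumes "open U" "p \<in> U" "\<And>q. q \<in> U \<Longrightarrow> f q = g q"
  shows "pdy f p = pdy g p"
proof (cases p)
  case (Pair x y)
  have "open ((\<lambda>t. (x, t)) -` U)"
    by (intro open_vimage assms(1) continuous_intros)
  then have "\<forall>\<^sub>F t in nhds y. f (x, t) = g (x, t)"
    using assms(2,3) Pair by (auto simp: eventually_nhds)
  then show ?thesis by (simp add: Pair pdy_def deriv_cong_ev)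
qed

lemma has_partials_on_cong:
  assumes "open U" and h: "has_partials_on U f fx fy" and e: "\<And>q. q \<in> U \<Longrightarrow> f q = g q"
  shows "has_partials_on U g fx fy"
  unfolding has_partials_on_def
proof (intro conjI allI impI)
  show "continuous_on U g"
    using h e unfolding has_partials_on_def by (metis continuous_on_cong)
  fix x y assume xy: "(x, y) \<in> U"
  have "open ((\<lambda>s. (s, y)) -` U)" "open ((\<lambda>t. (x, t)) -` U)"
    by (intro open_vimage assms(1) continuous_intros)+
  moreover have "((\<lambda>s. f (s, y)) has_field_derivative fx (x, y)) (at x)"
    "((\<lambda>t. f (x, t)) has_field_derivative fy (x, y)) (at y)"
    using h xy unfolding has_partials_on_def by blast+
  ultimately show "((\<lambda>s. g (s, y)) has_field_derivative fx (x, y)) (at x)"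
    "((\<lambda>t. g (x, t)) has_field_derivative fy (x, y)) (at y)"
    using xy e has_field_derivative_transform_within_open[of "\<lambda>s. f (s, y)" _ x _ "\<lambda>s. g (s, y)"]
      has_field_derivative_transform_within_open[of "\<lambda>t. f (x, t)" _ y _ "\<lambda>t. g (x, t)"]
    by (metis vimageI vimageD)+
qed

lemma times_cont_diff_on_Suc_iff:
  "times_cont_diff_on (Suc n) U f \<longleftrightarrow>
     has_partials_on U f (pdx f) (pdy f) \<and> times_cont_diff_on n U (pdx f) \<and> times_cont_diff_on n U (pdy f)"
  by (force simp: has_partials_on_def pdx_def pdy_def DERIV_deriv_iff_field_differentiable)

declare times_cont_diff_on.simps(2) [simp del]

lemma times_cont_diff_on_cong:
  assumes "open U" "\<And>q. q \<in> U \<Longrightarrow> f q = g q" "times_cont_diff_on n U f"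
  shows "times_cont_diff_on n U g"
  using assms(2,3)
proof (induction n arbitrary: f g)
  case 0
  then show ?case by (metis continuous_on_cong times_cont_diff_on.simps(1))
next
  case (Suc n)
  have ex: "pdx f q = pdx g q" and ey: "pdy f q = pdy g q" if "q \<in> U" for q
    using pdx_cong[OF assms(1) that, of f g] pdy_cong[OF assms(1) that, of f g] Suc.prems(1) by auto
  have "has_partials_on U g (pdx f) (pdy f)"
    using Suc.prems has_partials_on_cong[OF assms(1)] by (metis times_cont_diff_on_Suc_iff)
  then have "has_partials_on U g (pdx g) (pdy g)"
    by (simp add: has_partials_on_def ex ey)
  then show ?case
    using Suc.IH[of "pdx f" "pdx g"] Suc.IH[of "pdy f" "pdy g"] ex ey Suc.prems(2)
    by (simp add: times_cont_diff_on_Suc_iff)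
qed

lemma times_cont_diff_on_SucI:
  assumes "open U" "has_partials_on U f fx fy" "times_cont_diff_on n U fx" "times_cont_diff_on n U fy"
  shows "times_cont_diff_on (Suc n) U f"
proof -
  have "has_partials_on U f (pdx f) (pdy f)"
    using assms(2) has_partials_on_pdx[OF assms(2)] has_partials_on_pdy[OF assms(2)]
    by (simp add: has_partials_on_def)
  moreover have "times_cont_diff_on n U (pdx f)" "times_cont_diff_on n U (pdy f)"
    using times_cont_diff_on_cong[OF assms(1)] assms(3,4) has_partials_on_pdx[OF assms(2)]
      has_partials_on_pdy[OF assms(2)] by metis+
  ultimately show ?thesis by (simp add: times_cont_diff_on_Suc_iff)
qed

lemma times_cont_diff_on_lower: "times_cont_diff_on (Suc n) U f \<Longrightarrow> times_cont_diff_on n U f"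
proof (induction n arbitrary: f)
  case 0
  then show ?case by (simp add: times_cont_diff_on.simps(2))
next
  case (Suc n)
  note D = times_cont_diff_on_Suc_iff[THEN iffD1, OF Suc.prems]
  show ?case
    using D Suc.IH[of "pdx f"] Suc.IH[of "pdy f"] times_cont_diff_on_Suc_iff[of n U f] by blast
qed

lemma times_cont_diff_on_add:
  assumes "open U" "times_cont_diff_on n U f" "times_cont_diff_on n U g"
  shows "times_cont_diff_on n U (\<lambda>p. f p + g p)"
  using assms(2,3)
proof (induction n arbitrary: f g)
  case 0
  then show ?case by (simp add: continuous_on_add)
next
  case (Suc n)
  then show ?case
    by (intro times_cont_diff_on_SucI[OF assms(1) has_partials_on_add])
      (auto simp: times_cont_diff_on_Suc_iff)
qed

lemma times_cont_diff_on_mult: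
  assumes "open U" "times_cont_diff_on n U f" "times_cont_diff_on n U g"
  shows "times_cont_diff_on n U (\<lambda>p. f p * g p)"
  using assms(2,3)
proof (induction n arbitrary: f g)
  case 0
  then show ?case by (simp add: continuous_on_mult)
next
  case (Suc n)
  have "times_cont_diff_on n U f" "times_cont_diff_on n U g"
    using Suc.prems by (auto intro: times_cont_diff_on_lower)
  with Suc show ?case
    by (intro times_cont_diff_on_SucI[OF assms(1) has_partials_on_mult])
      (auto simp: times_cont_diff_on_Suc_iff intro!: times_cont_diff_on_add[OF assms(1)])
qed

lemma smooth2_onD:
  assumes "smooth2_on U f"
  shows "has_partials_on U f (pdx f) (pdy f)" "smooth2_on U (pdx f)" "smooth2_on U (pdy f)"
  using assms times_cont_diff_on_Suc_iff unfolding smooth2_on_def by blast+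

text \<open>As the order of differentiability is arbitrary, smooth partial derivatives suffice.\<close>

lemma smooth2_onI:
  assumes "open U" "has_partials_on U f fx fy" "smooth2_on U fx" "smooth2_on U fy"
  shows "smooth2_on U f"
  unfolding smooth2_on_def
proof
  fix n show "times_cont_diff_on n U f"
    using times_cont_diff_on_SucI[OF assms(1,2)] assms(3,4) times_cont_diff_on_lower
    unfolding smooth2_on_def by blast
qed

lemma smooth2_on_cong:
  "open U \<Longrightarrow> (\<And>q. q \<in> U \<Longrightarrow> f q = g q) \<Longrightarrow> smooth2_on U f \<Longrightarrow> smooth2_on U g"
  unfolding smooth2_on_def using times_cont_diff_on_cong by blast

lemma smooth2_on_add: "open U \<Longrightarrow> smooth2_on U f \<Longrightarrow> smooth2_on U g \<Longrightarrow> smooth2_on U (\<lambda>p. f p + g p)"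
  unfolding smooth2_on_def using times_cont_diff_on_add by blast

lemma smooth2_on_mult: "open U \<Longrightarrow> smooth2_on U f \<Longrightarrow> smooth2_on U g \<Longrightarrow> smooth2_on U (\<lambda>p. f p * g p)"
  unfolding smooth2_on_def using times_cont_diff_on_mult by blast

lemma smooth2_on_const:
  assumes "open U" shows "smooth2_on U (\<lambda>_. a)"
proof -
  have "times_cont_diff_on n U (\<lambda>_. a)" for n
  proof (induction n arbitrary: a)
    case (Suc n)
    then show ?case
      by (intro times_cont_diff_on_SucI[OF assms has_partials_on_const])
  qed simp
  then show ?thesis by (simp add: smooth2_on_def)
qed

lemma has_partials_on_fst: "has_partials_on U fst (\<lambda>_. 1) (\<lambda>_. 0)"
  and has_partials_on_snd: "has_partials_on U snd (\<lambda>_. 0) (\<lambda>_. 1)"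
  by (auto simp: has_partials_on_def intro!: continuous_intros)

lemma smooth2_on_fst: "open U \<Longrightarrow> smooth2_on U fst"
  and smooth2_on_snd: "open U \<Longrightarrow> smooth2_on U snd"
  by (blast intro: smooth2_onI has_partials_on_fst has_partials_on_snd smooth2_on_const)+

lemma has_partials_on_inverse:
  assumes "has_partials_on U f fx fy" "\<And>p. p \<in> U \<Longrightarrow> f p \<noteq> 0"
  shows "has_partials_on U (\<lambda>p. inverse (f p)) (\<lambda>p. - fx p * (inverse (f p) * inverse (f p)))
    (\<lambda>p. - fy p * (inverse (f p) * inverse (f p)))"
  using assms unfolding has_partials_on_def
  by (auto intro!: continuous_on_inverse derivative_eq_intros simp: mult_ac)

text \<open>The partial derivatives of \<open>1/f\<close> are smooth multiples of \<open>(1/f)\<^sup>2\<close>, so \<open>n\<close> times differentiable implies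
  \<open>n + 1\<close> times differentiable.  The exponential function is treated in the same way.\<close>

lemma smooth2_on_inverse:
  assumes "open U" "smooth2_on U f" "\<And>p. p \<in> U \<Longrightarrow> f p \<noteq> 0"
  shows "smooth2_on U (\<lambda>p. inverse (f p))"
proof -
  have neg: "smooth2_on U (\<lambda>p. - g p)" if "smooth2_on U g" for g
    using smooth2_on_mult[OF assms(1) smooth2_on_const[OF assms(1), of "-1"] that] by simp
  note D = smooth2_onD[OF assms(2)]
  have "times_cont_diff_on n U (\<lambda>p. inverse (f p))" for n
  proof (induction n)
    case 0
    show ?case using has_partials_on_inverse[OF D(1) assms(3)] by (simp add: has_partials_on_def)
  next
    case (Suc n)
    show ?case
      using neg[OF D(2)] neg[OF D(3)] Suc
      by (intro times_cont_diff_on_SucI[OF assms(1) has_partials_on_inverse[OF D(1) assms(3)]]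
          times_cont_diff_on_mult assms(1)) (auto simp: smooth2_on_def)
  qed
  then show ?thesis by (simp add: smooth2_on_def)
qed

lemma has_partials_on_exp:
  fixes f :: "('k::{real_normed_field,banach} \<times> 'k) \<Rightarrow> 'k"
  assumes "has_partials_on U f fx fy"
  shows "has_partials_on U (\<lambda>p. exp (f p)) (\<lambda>p. fx p * exp (f p)) (\<lambda>p. fy p * exp (f p))"
  using assms unfolding has_partials_on_def
  by (auto intro!: continuous_on_exp derivative_eq_intros simp: mult_ac)

lemma smooth2_on_exp:
  fixes f :: "('k::{real_normed_field,banach} \<times> 'k) \<Rightarrow> 'k"
  assumes "open U" "smooth2_on U f"
  shows "smooth2_on U (\<lambda>p. exp (f p))"
proof -
  note D = smooth2_onD[OF assms(2)]
  have "times_cont_diff_on n U (\<lambda>p. exp (f p))" for n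
  proof (induction n)
    case 0
    show ?case using has_partials_on_exp[OF D(1)] by (simp add: has_partials_on_def)
  next
    case (Suc n)
    then show ?case
      using D by (intro times_cont_diff_on_SucI[OF assms(1) has_partials_on_exp[OF D(1)]]
          times_cont_diff_on_mult assms(1)) (auto simp: smooth2_on_def)
  qed
  then show ?thesis by (simp add: smooth2_on_def)
qed

lemma smooth2_on_sum:
  assumes "open U" "\<And>i. i \<in> I \<Longrightarrow> smooth2_on U (f i)"
  shows "smooth2_on U (\<lambda>p. \<Sum>i\<in>I. f i p)"
  using assms(2)
  by (induction I rule: infinite_finite_induct) (auto intro: smooth2_on_add smooth2_on_const assms(1))

lemma smooth2_on_continuous: "smooth2_on U f \<Longrightarrow> continuous_on U f"
  unfolding smooth2_on_def by (metis times_cont_diff_on.simps(1))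

lemma smooth2_on_has_derivative:
  assumes "open U" "smooth2_on U f" "p \<in> U"
  shows "(f has_derivative (\<lambda>v. pdx f p * fst v + pdy f p * snd v)) (at p)"
proof -
  obtain x y where p: "p = (x, y)" by (cases p)
  obtain S T where ST: "open S" "open T" "(x, y) \<in> S \<times> T" "S \<times> T \<subseteq> U"
    using open_prod_elim[OF assms(1), of "(x, y)"] assms(3) p by (metis mem_Sigma_iff)
  then obtain e where e: "e > 0" "ball y e \<subseteq> T"
    by (metis mem_Sigma_iff open_contains_ball)
  let ?S = "S" and ?T = "ball y e"
  have sub: "?S \<times> ?T \<subseteq> U" using ST(4) e by auto
  note D = smooth2_onD[OF assms(2)]
  have "((\<lambda>(x, y). f (x, y)) has_derivative
      (\<lambda>(tx, ty). pdx f (x, y) * tx + blinfun_mult_right (pdy f (x, y)) ty)) (at (x, y) within ?S \<times> ?T)"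
  proof (rule has_derivative_partialsI)
    show "((\<lambda>x. f (x, y)) has_derivative (*) (pdx f (x, y))) (at x within ?S)"
      using D(1) assms(3) p unfolding has_partials_on_def
      by (auto intro: has_field_derivative_at_within simp flip: has_field_derivative_def)
    show "((\<lambda>y. f (x, y)) has_derivative blinfun_apply (blinfun_mult_right (pdy f (x, y))))
        (at y within ?T)" if "x \<in> ?S" "y \<in> ?T" for x y
      using D(1) subsetD[OF sub, of "(x, y)"] that unfolding has_partials_on_def
      by (auto intro: has_field_derivative_at_within simp flip: has_field_derivative_def)
    have "continuous_on (?S \<times> ?T) (pdy f)"
      using smooth2_on_continuous[OF D(3)] sub by (rule continuous_on_subset)
    then show "continuous (at (x, y) within ?S \<times> ?T) (\<lambda>(x, y). blinfun_mult_right (pdy f (x, y)))"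
      using ST(3) e unfolding split_beta
      by (auto intro!: bounded_linear.continuous[OF bounded_linear_blinfun_mult_right]
          simp: continuous_on_eq_continuous_within)
  qed (use e in auto)
  moreover have "at (x, y) within ?S \<times> ?T = at (x, y)"
    using ST e by (intro at_within_open) (auto intro: open_Times)
  ultimately show ?thesis by (simp add: p case_prod_unfold)
qed

text \<open>
  Two applications of the mean value inequality, in \<open>x\<close> and then in \<open>y\<close>, compare the second difference
  \<open>\<Delta>(h)\<close> with \<open>h\<^sup>2 f\<^sub>x\<^sub>y\<close>.  As \<open>\<Delta>(h)\<close> is symmetric in the two variables, both iterated partial derivatives
  are limits of \<open>\<Delta>(h)/h\<^sup>2\<close> and hence agree.
\<close>

lemma second_difference_estimate:
  fixes f :: "('k::real_normed_field \<times> 'k) \<Rightarrow> 'k"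
  assumes "open U" "has_partials_on U f fx fy" "has_partials_on U fx fxx fxy"
    "continuous_on U fxy" "(x, y) \<in> U" "e > 0"
  obtains d where "d > 0" "\<And>h. norm h \<le> d \<Longrightarrow>
    norm ((f (x + h, y + h) - f (x + h, y)) - (f (x, y + h) - f (x, y)) - h * h * fxy (x, y))
      \<le> e * norm h * norm h"
proof -
  obtain d1 where d1: "d1 > 0" "\<And>q. q \<in> U \<Longrightarrow> dist q (x, y) < d1 \<Longrightarrow> dist (fxy q) (fxy (x, y)) < e"
    using assms(4,5,6) unfolding continuous_on_iff by metis
  obtain d2 where d2: "d2 > 0" "ball (x, y) d2 \<subseteq> U"
    using assms(1,5) open_contains_ball by blast
  define d where "d = min d1 d2 / 4"
  have d0: "d > 0" using d1 d2 by (simp add: d_def)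
  have near: "(x + s, y + t) \<in> U \<and> norm (fxy (x + s, y + t) - fxy (x, y)) \<le> e"
    if "norm s \<le> d" "norm t \<le> d" for s t
  proof -
    have "dist (x + s, y + t) (x, y) \<le> norm s + norm t"
      by (simp add: dist_norm norm_Pair sqrt_sum_squares_le_sum)
    also have "\<dots> < min d1 d2" using that d0 unfolding d_def by linarith
    finally show ?thesis
      using d1(2)[of "(x + s, y + t)"] subsetD[OF d2(2), of "(x + s, y + t)"]
      by (simp add: dist_commute[of "(x, y)"]) (simp add: dist_norm less_imp_le)
  qed
  have shift: "((\<lambda>t. a + t) has_field_derivative 1) (at t within S)" for a t :: 'k and S
    by (rule derivative_eq_intros refl | simp)+
  have inner: "norm ((fx (x + s, y + t) - t * fxy (x, y)) - (fx (x + s, y + 0) - 0 * fxy (x, y))) \<le> e * norm (t - 0)"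
    if "norm s \<le> d" "norm t \<le> d" for s t
  proof (rule field_differentiable_bound[where S = "cball 0 d" and f = "\<lambda>t. fx (x + s, y + t) - t * fxy (x, y)"
        and f' = "\<lambda>t. fxy (x + s, y + t) - fxy (x, y)"])
    fix t assume "t \<in> cball (0::'k) d"
    then have n: "(x + s, y + t) \<in> U \<and> norm (fxy (x + s, y + t) - fxy (x, y)) \<le> e"
      using near that by simp
    then show "norm (fxy (x + s, y + t) - fxy (x, y)) \<le> e" by simp
    have "((\<lambda>t. fx (x + s, t)) has_field_derivative fxy (x + s, y + t)) (at (y + t))"
      using assms(3) n unfolding has_partials_on_def by blast
    then have "((\<lambda>t. fx (x + s, y + t)) has_field_derivative fxy (x + s, y + t)) (at t within cball 0 d)"
      using DERIV_chain2[OF _ shift, of "\<lambda>t. fx (x + s, t)" _ y t "cball 0 d"] by simp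
    then show "((\<lambda>t. fx (x + s, y + t) - t * fxy (x, y)) has_field_derivative
        fxy (x + s, y + t) - fxy (x, y)) (at t within cball 0 d)"
      by (rule DERIV_diff) (auto intro!: derivative_eq_intros)
  qed (use that d0 in auto)
  show thesis
  proof (rule that[OF d0])
    fix h :: 'k assume h: "norm h \<le> d"
    have "norm ((f (x + h, y + h) - f (x + h, y) - h * (h * fxy (x, y)))
        - (f (x + 0, y + h) - f (x + 0, y) - 0 * (h * fxy (x, y)))) \<le> (e * norm h) * norm (h - 0)"
    proof (rule field_differentiable_bound[where S = "cball 0 d"
          and f = "\<lambda>s. f (x + s, y + h) - f (x + s, y) - s * (h * fxy (x, y))"
          and f' = "\<lambda>s. fx (x + s, y + h) - fx (x + s, y) - h * fxy (x, y)"])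
      fix s assume s: "s \<in> cball (0::'k) d"
      then show "norm (fx (x + s, y + h) - fx (x + s, y) - h * fxy (x, y)) \<le> e * norm h"
        using inner[of s h] h by (simp add: algebra_simps)
      have "((\<lambda>s. f (s, y + t)) has_field_derivative fx (x + s, y + t)) (at (x + s))" if "norm t \<le> d" for t
        using assms(2) near[of s t] s that unfolding has_partials_on_def by simp
      then have "((\<lambda>s. f (x + s, y + t)) has_field_derivative fx (x + s, y + t)) (at s)" if "norm t \<le> d" for t
        using that DERIV_chain2[OF _ shift, of "\<lambda>s. f (s, y + t)" _ x s UNIV] by simp
      from this[OF h] this[of 0]
      have "((\<lambda>s. f (x + s, y + h)) has_field_derivative fx (x + s, y + h)) (at s within cball 0 d)"
        "((\<lambda>s. f (x + s, y)) has_field_derivative fx (x + s, y)) (at s within cball 0 d)"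
        using d0 by (auto intro: has_field_derivative_at_within)
      then show "((\<lambda>s. f (x + s, y + h) - f (x + s, y) - s * (h * fxy (x, y))) has_field_derivative
          fx (x + s, y + h) - fx (x + s, y) - h * fxy (x, y)) (at s within cball 0 d)"
        by (auto intro!: derivative_eq_intros)
    qed (use h d0 in auto)
    then show "norm ((f (x + h, y + h) - f (x + h, y)) - (f (x, y + h) - f (x, y)) - h * h * fxy (x, y))
      \<le> e * norm h * norm h" by (simp add: algebra_simps)
  qed
qed

lemma pdx_pdy_commute:
  fixes f :: "('k::real_normed_field \<times> 'k) \<Rightarrow> 'k"
  assumes "open U" "smooth2_on U f" "p \<in> U"
  shows "pdx (pdy f) p = pdy (pdx f) p"
proof (rule ccontr)
  assume ne: "\<not> ?thesis"
  obtain x y where p: "p = (x, y)" by (cases p)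
  let ?a = "pdy (pdx f) (x, y)" and ?b = "pdx (pdy f) (x, y)"
  define e where "e = norm (?a - ?b) / 3"
  have e: "e > 0" using ne p by (simp add: e_def)
  note D = smooth2_onD[OF assms(2)]
  obtain d where d: "d > 0" "\<And>h. norm h \<le> d \<Longrightarrow>
    norm ((f (x + h, y + h) - f (x + h, y)) - (f (x, y + h) - f (x, y)) - h * h * ?a)
      \<le> e * norm h * norm h"
    using second_difference_estimate[OF assms(1) D(1) smooth2_onD(1)[OF D(2)]
        smooth2_on_continuous[OF smooth2_onD(3)[OF D(2)]] _ e, of x y] assms(3) p by blast
  have sw: "has_partials_on (prod.swap -` U) (g \<circ> prod.swap) (gy \<circ> prod.swap) (gx \<circ> prod.swap)"
    if "has_partials_on U g gx gy" for g gx gy :: "('k \<times> 'k) \<Rightarrow> 'k"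
    using that unfolding has_partials_on_def
    by (auto intro!: continuous_on_compose2[of U g] continuous_intros simp: comp_def)
  have swU: "open (prod.swap -` U)"
    by (intro open_vimage assms(1) continuous_intros)
  have "continuous_on (prod.swap -` U) (pdx (pdy f) \<circ> prod.swap)"
    using smooth2_on_continuous[OF smooth2_onD(2)[OF D(3)]]
    by (auto intro!: continuous_on_compose2[of U] continuous_intros simp: comp_def)
  from second_difference_estimate[OF swU sw[OF D(1)] sw[OF smooth2_onD(1)[OF D(3)]] this _ e, of y x]
  obtain d' where d': "d' > 0" "\<And>h. norm h \<le> d' \<Longrightarrow>
    norm ((f (x + h, y + h) - f (x, y + h)) - (f (x + h, y) - f (x, y)) - h * h * ?b)
      \<le> e * norm h * norm h"
    using assms(3) p by (auto simp: comp_def)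
  define h :: 'k where "h = of_real (min d d')"
  have h: "norm h = min d d'" "norm h > 0" using d d' by (auto simp: h_def)
  have "norm (h * h * (?a - ?b)) \<le> e * norm h * norm h + e * norm h * norm h"
    using d(2)[of h] d'(2)[of h] h
      norm_triangle_ineq4[of "(f (x + h, y + h) - f (x, y + h)) - (f (x + h, y) - f (x, y)) - h * h * ?b"
        "(f (x + h, y + h) - f (x + h, y)) - (f (x, y + h) - f (x, y)) - h * h * ?a"]
    by (simp add: algebra_simps)
  then have "norm h * norm h * norm (?a - ?b) \<le> norm h * norm h * (2 * e)"
    by (simp only: norm_mult) (simp add: mult_ac)
  then have "norm (?a - ?b) \<le> 2 * e"
    using h(2) by simp
  then show False using e by (simp add: e_def)
qed

section \<open>Smooth curves\<close>

text \<open>Differentiability of finite order, for inductions on the order.\<close>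

definition curve_diff_on :: "nat \<Rightarrow> 'k set \<Rightarrow> ('k::real_normed_field \<Rightarrow> 'k) \<Rightarrow> bool" where
  "curve_diff_on n S f \<longleftrightarrow> (\<forall>k<n. \<forall>t\<in>S. (deriv ^^ k) f field_differentiable (at t))"

lemma smooth1_on_iff: "smooth1_on S f \<longleftrightarrow> (\<forall>n. curve_diff_on n S f)"
  unfolding smooth1_on_def curve_diff_on_def by blast

lemma curve_diff_on_0 [simp]: "curve_diff_on 0 S f"
  by (simp add: curve_diff_on_def)

lemma curve_diff_on_Suc:
  "curve_diff_on (Suc n) S f \<longleftrightarrow> (\<forall>t\<in>S. f field_differentiable (at t)) \<and> curve_diff_on n S (deriv f)"
  unfolding curve_diff_on_def by (auto simp: All_less_Suc2 funpow_Suc_right simp del: funpow.simps)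

lemma curve_diff_on_lower: "curve_diff_on (Suc n) S f \<Longrightarrow> curve_diff_on n S f"
  by (simp add: curve_diff_on_def)

lemma deriv_cong_open:
  assumes "open S" "t \<in> S" "\<And>s. s \<in> S \<Longrightarrow> f s = g s"
  shows "deriv f t = deriv g t"
  using assms by (intro deriv_cong_ev) (auto simp: eventually_nhds)

lemma higher_deriv_cong_open:
  assumes "open S" "t \<in> S" "\<And>s. s \<in> S \<Longrightarrow> f s = g s"
  shows "(deriv ^^ n) f t = (deriv ^^ n) g t"
  using assms(2)
proof (induction n arbitrary: t)
  case (Suc n)
  then show ?case using deriv_cong_open[OF assms(1) Suc.prems, of "(deriv ^^ n) f" "(deriv ^^ n) g"] by simp
qed (simp add: assms(3))

lemma curve_diff_on_cong:
  assumes "open S" "\<And>s. s \<in> S \<Longrightarrow> f s = g s" "curve_diff_on n S f"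
  shows "curve_diff_on n S g"
  unfolding curve_diff_on_def
proof (intro allI ballI impI)
  fix k t assume k: "k < n" "t \<in> S"
  then obtain D where "((deriv ^^ k) f has_field_derivative D) (at t)"
    using assms(3) by (auto simp: curve_diff_on_def field_differentiable_def)
  then have "((deriv ^^ k) g has_field_derivative D) (at t)"
    by (rule has_field_derivative_transform_within_open[OF _ assms(1) k(2)])
      (use assms(1,2) in \<open>auto intro: higher_deriv_cong_open\<close>)
  then show "(deriv ^^ k) g field_differentiable at t"
    by (auto simp: field_differentiable_def)
qed

lemma curve_diff_on_SucI:
  assumes "open S" "\<And>t. t \<in> S \<Longrightarrow> (f has_field_derivative f' t) (at t)" "curve_diff_on n S f'"
  shows "curve_diff_on (Suc n) S f"
proof -
  have "deriv f t = f' t" if "t \<in> S" for t using assms(2)[OF that] by (rule DERIV_imp_deriv)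
  then have "curve_diff_on n S (deriv f)"
    using curve_diff_on_cong[OF assms(1) _ assms(3), of "deriv f"] by simp
  then show ?thesis using assms(2) by (auto simp: curve_diff_on_Suc field_differentiable_def)
qed

lemma curve_diff_on_add:
  assumes "open S" "curve_diff_on n S f" "curve_diff_on n S g"
  shows "curve_diff_on n S (\<lambda>t. f t + g t)"
  using assms(2,3)
proof (induction n arbitrary: f g)
  case (Suc n)
  show ?case
    by (rule curve_diff_on_SucI[OF assms(1), of _ "\<lambda>t. deriv f t + deriv g t"])
      (use Suc in \<open>auto simp: curve_diff_on_Suc simp flip: DERIV_deriv_iff_field_differentiable intro: DERIV_add\<close>)
qed simp

lemma curve_diff_on_mult:
  assumes "open S" "curve_diff_on n S f" "curve_diff_on n S g"
  shows "curve_diff_on n S (\<lambda>t. f t * g t)"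
  using assms(2,3)
proof (induction n arbitrary: f g)
  case (Suc n)
  have "curve_diff_on n S f" "curve_diff_on n S g"
    using Suc.prems by (auto intro: curve_diff_on_lower)
  with Suc show ?case
    by (intro curve_diff_on_SucI[OF assms(1), of _ "\<lambda>t. deriv f t * g t + f t * deriv g t"] curve_diff_on_add assms(1))
      (auto simp: curve_diff_on_Suc simp flip: DERIV_deriv_iff_field_differentiable intro!: derivative_eq_intros)
qed simp

lemma has_field_derivative_along_curve:
  fixes f :: "('k::real_normed_field \<times> 'k) \<Rightarrow> 'k"
  assumes "open U" "smooth2_on U f" "(x t, y t) \<in> U"
    "(x has_field_derivative x') (at t)" "(y has_field_derivative y') (at t)"
  shows "((\<lambda>t. f (x t, y t)) has_field_derivative pdx f (x t, y t) * x' + pdy f (x t, y t) * y') (at t)"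
proof -
  have "((\<lambda>t. (x t, y t)) has_derivative (\<lambda>h. (x' * h, y' * h))) (at t)"
    using assms(4,5) by (auto intro!: has_derivative_Pair simp: has_field_derivative_def)
  from has_derivative_compose[OF this smooth2_on_has_derivative[OF assms(1-3)]]
  show ?thesis
    unfolding has_field_derivative_def by (rule has_derivative_eq_rhs) (auto simp: algebra_simps)
qed

text \<open>By the chain rule the derivative of \<open>f \<circ> \<gamma>\<close> involves the functions \<open>f\<^sub>x \<circ> \<gamma>\<close> and \<open>f\<^sub>y \<circ> \<gamma>\<close>, to which the
  induction hypothesis applies.\<close>

lemma curve_diff_on_compose:
  assumes "open U" "open S" "smooth2_on U f" "\<And>t. t \<in> S \<Longrightarrow> (x t, y t) \<in> U"
    "curve_diff_on n S x" "curve_diff_on n S y"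
  shows "curve_diff_on n S (\<lambda>t. f (x t, y t))"
  using assms(3,5,6)
proof (induction n arbitrary: f)
  case (Suc n)
  have xy: "(x has_field_derivative deriv x t) (at t)" "(y has_field_derivative deriv y t) (at t)"
    if "t \<in> S" for t
    using Suc.prems that by (auto simp: curve_diff_on_Suc DERIV_deriv_iff_field_differentiable)
  have lower: "curve_diff_on n S x" "curve_diff_on n S y" "curve_diff_on n S (deriv x)" "curve_diff_on n S (deriv y)"
    using Suc.prems by (auto simp: curve_diff_on_Suc intro: curve_diff_on_lower)
  show ?case
    by (rule curve_diff_on_SucI[OF assms(2), of _
          "\<lambda>t. pdx f (x t, y t) * deriv x t + pdy f (x t, y t) * deriv y t"])
      (use Suc assms(4) lower xy in \<open>auto intro!: has_field_derivative_along_curve[OF assms(1)]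
          curve_diff_on_add curve_diff_on_mult assms(2) Suc.IH smooth2_onD\<close>)
qed simp

lemma smooth1_on_compose:
  assumes "open U" "open S" "smooth2_on U f" "\<And>t. t \<in> S \<Longrightarrow> (x t, y t) \<in> U" "smooth1_on S x" "smooth1_on S y"
  shows "smooth1_on S (\<lambda>t. f (x t, y t))"
  using assms curve_diff_on_compose unfolding smooth1_on_iff by blast

lemma smooth1_on_mult:
  "open S \<Longrightarrow> smooth1_on S f \<Longrightarrow> smooth1_on S g \<Longrightarrow> smooth1_on S (\<lambda>t. f t * g t)"
  using curve_diff_on_mult unfolding smooth1_on_iff by blast

lemma smooth1_on_add:
  "open S \<Longrightarrow> smooth1_on S f \<Longrightarrow> smooth1_on S g \<Longrightarrow> smooth1_on S (\<lambda>t. f t + g t)"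
  using curve_diff_on_add unfolding smooth1_on_iff by blast

lemma smooth1_on_const: "smooth1_on S (\<lambda>_. a)"
proof -
  have "(deriv ^^ n) (\<lambda>_. a) = (\<lambda>_. if n = 0 then a else 0)" for n
    by (induction n) auto
  then show ?thesis by (auto simp: smooth1_on_def)
qed

lemma smooth1_on_id: "open S \<Longrightarrow> smooth1_on S (\<lambda>t. t)"
  unfolding smooth1_on_iff
proof
  fix n assume "open S"
  then show "curve_diff_on n S (\<lambda>t. t)"
    using smooth1_on_const[of S 1]
    by (cases n) (auto intro!: curve_diff_on_SucI[of _ _ "\<lambda>_. 1"] simp: smooth1_on_iff)
qed

lemma smooth1_on_subset: "smooth1_on S f \<Longrightarrow> T \<subseteq> S \<Longrightarrow> smooth1_on T f"
  by (auto simp: smooth1_on_def)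

lemma smooth1_onD:
  assumes "smooth1_on S f" "t \<in> S"
  shows "(f has_field_derivative deriv f t) (at t)"
    and "(deriv f has_field_derivative deriv (deriv f) t) (at t)"
proof -
  have "(deriv ^^ 0) f field_differentiable at t" "(deriv ^^ 1) f field_differentiable at t"
    using assms unfolding smooth1_on_def by blast+
  then show "(f has_field_derivative deriv f t) (at t)"
    "(deriv f has_field_derivative deriv (deriv f) t) (at t)"
    by (simp_all add: DERIV_deriv_iff_field_differentiable)
qed

section \<open>Linear differential equations along a segment\<close>

text \<open>
  Gronwall's argument: \<open>exp (-2Kt) |Z|\<^sup>2\<close> does not increase.
\<close>

lemma linear_growth_zero:
  fixes Z Z' :: "real \<Rightarrow> 'v::real_inner"
  assumes Z: "\<And>t. t \<in> {0..1} \<Longrightarrow> (Z has_vector_derivative Z' t) (at t within {0..1})"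
    and bound: "\<And>t. t \<in> {0..1} \<Longrightarrow> norm (Z' t) \<le> K * norm (Z t)"
    and "Z 0 = 0"
  shows "Z 1 = 0"
proof -
  let ?N = "\<lambda>t. exp (- 2 * K * t) * (Z t \<bullet> Z t)"
  have "?N 1 \<le> ?N 0"
  proof (rule DERIV_nonpos_imp_decreasing_open[of 0 1])
    fix t :: real assume t: "0 < t" "t < 1"
    then have "(Z has_vector_derivative Z' t) (at t within {0<..<1})"
      using Z[of t] by (auto elim: has_vector_derivative_within_subset)
    then have "(Z has_vector_derivative Z' t) (at t)"
      using t by (simp add: at_within_open[of _ "{0<..<1}"])
    then have "((\<lambda>t. Z t \<bullet> Z t) has_real_derivative 2 * (Z t \<bullet> Z' t)) (at t)"
      unfolding has_vector_derivative_def has_field_derivative_def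
      by (auto intro!: derivative_eq_intros simp: inner_commute)
    then have d: "(?N has_real_derivative
        exp (- 2 * K * t) * (- 2 * K) * (Z t \<bullet> Z t) + exp (- 2 * K * t) * (2 * (Z t \<bullet> Z' t))) (at t)"
      by (auto intro!: derivative_eq_intros)
    have "Z t \<bullet> Z' t \<le> norm (Z t) * norm (Z' t)" by (rule norm_cauchy_schwarz)
    also have "\<dots> \<le> norm (Z t) * (K * norm (Z t))"
      using bound t by (intro mult_left_mono) auto
    also have "\<dots> = K * (Z t \<bullet> Z t)" by (simp add: dot_square_norm power2_eq_square)
    finally have "exp (- 2 * K * t) * (2 * (Z t \<bullet> Z' t)) \<le> exp (- 2 * K * t) * (2 * (K * (Z t \<bullet> Z t)))"
      by (intro mult_left_mono) auto
    then have "exp (- 2 * K * t) * (- 2 * K) * (Z t \<bullet> Z t) + exp (- 2 * K * t) * (2 * (Z t \<bullet> Z' t)) \<le> 0"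
      by (simp add: algebra_simps)
    then show "\<exists>y. (?N has_real_derivative y) (at t) \<and> y \<le> 0" using d by blast
  next
    have "continuous_on {0..1} Z"
      using Z by (intro continuous_on_vector_derivative) auto
    then show "continuous_on {0..1} ?N" by (intro continuous_intros)
  qed simp
  then have "exp (- 2 * K) * (Z 1 \<bullet> Z 1) \<le> 0" using assms(3) by simp
  then have "Z 1 \<bullet> Z 1 \<le> 0" by (simp add: mult_le_0_iff)
  then show ?thesis using inner_ge_zero[of "Z 1"] by (simp add: antisym)
qed

lemma norm_matrix_vector_mult_le:
  fixes A :: "'k::{real_normed_field,euclidean_space}^'n^'m"
  assumes "\<And>i j. norm (A $ i $ j) \<le> K"
  shows "norm (A *v v) \<le> (of_nat CARD('m) * (of_nat CARD('n) * K)) * norm v"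
proof -
  have "norm (A *v v) \<le> (\<Sum>i\<in>UNIV. norm ((A *v v) $ i))"
    by (simp add: norm_vec_def L2_set_le_sum)
  also have "\<dots> \<le> (\<Sum>i\<in>(UNIV::'m set). \<Sum>j\<in>(UNIV::'n set). K * norm v)"
  proof (rule sum_mono)
    fix i :: 'm
    have "norm ((A *v v) $ i) \<le> (\<Sum>j\<in>UNIV. norm (A $ i $ j * v $ j))"
      unfolding matrix_vector_mult_def by (simp add: norm_sum)
    also have "\<dots> \<le> (\<Sum>j\<in>(UNIV::'n set). K * norm v)"
    proof (rule sum_mono)
      fix j :: 'n
      have "0 \<le> K" using assms[of i j] norm_ge_zero order_trans by blast
      then show "norm (A $ i $ j * v $ j) \<le> K * norm v"
        unfolding norm_mult by (intro mult_mono assms Finite_Cartesian_Product.norm_nth_le) auto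
    qed
    finally show "norm ((A *v v) $ i) \<le> (\<Sum>j\<in>(UNIV::'n set). K * norm v)" .
  qed
  also have "\<dots> = (of_nat CARD('m) * (of_nat CARD('n) * K)) * norm v" by simp
  finally show ?thesis .
qed

text \<open>Row \<open>k\<close> of \<open>A M\<close> is a combination of the rows of \<open>M\<close>, and every term but \<open>A\<^sub>k\<^sub>k M\<^sub>k\<close> repeats
  another row.\<close>

lemma sum_det_row_replaced:
  fixes A M :: "'k::comm_ring_1^'n^'n"
  shows "(\<Sum>k\<in>UNIV. det (\<chi> i. if i = k then (A ** M) $ i else M $ i)) = trace A * det M"
proof -
  have "det (\<chi> i. if i = k then (A ** M) $ i else M $ i) = A $ k $ k * det M" for k
  proof -
    have row: "(A ** M) $ k = (\<Sum>j\<in>UNIV. A $ k $ j *s M $ j)"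
      by (simp add: vec_eq_iff matrix_matrix_mult_def)
    have "det (\<chi> i. if i = k then (A ** M) $ i else M $ i)
        = det (\<chi> i. if i = k then (\<Sum>j\<in>UNIV. A $ k $ j *s M $ j) else M $ i)"
      by (rule arg_cong[where f = det]) (simp add: row[symmetric] vec_eq_iff)
    also have "\<dots> = (\<Sum>j\<in>UNIV. det (\<chi> i. if i = k then A $ k $ j *s M $ j else M $ i))"
      by (rule det_linear_row_sum) simp
    also have "\<dots> = (\<Sum>j\<in>UNIV. A $ k $ j * det (\<chi> i. if i = k then M $ j else M $ i))"
      by (rule sum.cong) (simp_all add: det_row_mul)
    also have "\<dots> = (\<Sum>j\<in>UNIV. if j = k then A $ k $ j * det M else 0)"
    proof (rule sum.cong[OF refl])
      fix j
      show "A $ k $ j * det (\<chi> i. if i = k then M $ j else M $ i) = (if j = k then A $ k $ j * det M else 0)"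
      proof (cases "j = k")
        case True
        then have "(\<chi> i. if i = k then M $ j else M $ i) = M" by (simp add: vec_eq_iff)
        then show ?thesis using True by simp
      next
        case False
        then have "det (\<chi> i. if i = k then M $ j else M $ i) = 0"
          by (intro det_identical_rows[of j k]) (auto simp: row_def vec_eq_iff)
        then show ?thesis using False by simp
      qed
    qed
    also have "\<dots> = A $ k $ k * det M" by simp
    finally show ?thesis .
  qed
  then show ?thesis by (simp add: trace_def sum_distrib_right)
qed

text \<open>Liouville's formula for solutions of \<open>M' = A M\<close>: the product rule replaces one row at a time by
  its derivative.\<close>

lemma has_vector_derivative_det:
  fixes M :: "real \<Rightarrow> 'k::real_normed_field^'n^'n"
  assumes "\<And>i j. ((\<lambda>t. M t $ i $ j) has_vector_derivative (A ** M t) $ i $ j) (at t within S)"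
  shows "((\<lambda>t. det (M t)) has_vector_derivative trace A * det (M t)) (at t within S)"
proof -
  let ?P = "{\<sigma>. \<sigma> permutes (UNIV :: 'n set)}"
  have prod: "(\<Prod>i\<in>UNIV. (if i = k then (A ** M t) $ i else M t $ i) $ \<sigma> i)
      = (A ** M t) $ k $ \<sigma> k * (\<Prod>i\<in>UNIV - {k}. M t $ i $ \<sigma> i)" for k and \<sigma> :: "'n \<Rightarrow> 'n"
    by (subst prod.remove[of _ k]) (auto intro!: arg_cong2[where f = "(*)"] prod.cong)
  have "((\<lambda>t. det (M t)) has_derivative
      (\<lambda>h. \<Sum>\<sigma>\<in>?P. of_int (sign \<sigma>) * (\<Sum>k\<in>UNIV. (h *\<^sub>R (A ** M t) $ k $ \<sigma> k) * (\<Prod>i\<in>UNIV - {k}. M t $ i $ \<sigma> i))))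
      (at t within S)"
    unfolding det_def
    by (intro has_derivative_sum has_derivative_mult_right has_derivative_prod)
      (use assms in \<open>simp add: has_vector_derivative_def\<close>)
  moreover have "(\<Sum>\<sigma>\<in>?P. of_int (sign \<sigma>) * (\<Sum>k\<in>UNIV. (h *\<^sub>R (A ** M t) $ k $ \<sigma> k) * (\<Prod>i\<in>UNIV - {k}. M t $ i $ \<sigma> i)))
      = h *\<^sub>R (trace A * det (M t))" for h
  proof -
    have "(\<Sum>\<sigma>\<in>?P. of_int (sign \<sigma>) * (\<Sum>k\<in>UNIV. (h *\<^sub>R (A ** M t) $ k $ \<sigma> k) * (\<Prod>i\<in>UNIV - {k}. M t $ i $ \<sigma> i)))
        = h *\<^sub>R (\<Sum>\<sigma>\<in>?P. \<Sum>k\<in>UNIV. of_int (sign \<sigma>) * ((A ** M t) $ k $ \<sigma> k * (\<Prod>i\<in>UNIV - {k}. M t $ i $ \<sigma> i)))"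
      by (simp add: scaleR_sum_right sum_distrib_left)
    also have "\<dots> = h *\<^sub>R (\<Sum>k\<in>UNIV. det (\<chi> i. if i = k then (A ** M t) $ i else M t $ i))"
      unfolding det_def by (subst sum.swap) (simp add: prod)
    finally show ?thesis by (simp only: sum_det_row_replaced)
  qed
  ultimately show ?thesis unfolding has_vector_derivative_def by simp
qed

section \<open>The frame of a solution\<close>

definition solves ::
  "('k \<times> 'k \<Rightarrow> 'k) \<Rightarrow> ('k \<times> 'k \<Rightarrow> 'k) \<Rightarrow> ('k \<times> 'k \<Rightarrow> 'k) \<Rightarrow> ('k \<times> 'k \<Rightarrow> 'k) \<Rightarrow>
   ('k \<times> 'k) set \<Rightarrow> ('k \<times> 'k \<Rightarrow> 'k::real_normed_field) \<Rightarrow> bool" where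
  "solves b \<mu> c \<nu> U z \<longleftrightarrow> smooth2_on U z \<and>
     (\<forall>p\<in>U. pdx (pdx z) p = b p * pdy z p + \<mu> p * z p \<and>
            pdy (pdy z) p = c p * pdx z p + \<nu> p * z p)"

lemma mem_solution_space_iff:
  "z \<in> solution_space b \<mu> c \<nu> U \<longleftrightarrow> solves b \<mu> c \<nu> U z \<and> (\<forall>p. p \<notin> U \<longrightarrow> z p = 0)"
  by (auto simp: solution_space_def solves_def)

lemma vector_4 [simp]:
  "(vector [a, b, c, d] :: 'a::zero^4) $ 1 = a"
  "(vector [a, b, c, d] :: 'a::zero^4) $ 2 = b"
  "(vector [a, b, c, d] :: 'a::zero^4) $ 3 = c"
  "(vector [a, b, c, d] :: 'a::zero^4) $ 4 = d"
  unfolding vector_def by simp_all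

text \<open>The system reduces all further derivatives of a solution to these four.\<close>

definition frame :: "('k \<times> 'k \<Rightarrow> 'k::real_normed_field) \<Rightarrow> 'k \<times> 'k \<Rightarrow> 'k ^ 4" where
  "frame z p = vector [z p, pdx z p, pdy z p, pdy (pdx z) p]"

lemma smooth2_on_frame:
  assumes "smooth2_on U z" shows "smooth2_on U (\<lambda>p. frame z p $ j)"
proof -
  have "\<forall>j. smooth2_on U (\<lambda>p. frame z p $ j)"
    unfolding forall_4 frame_def by (simp add: assms smooth2_onD)
  then show ?thesis ..
qed

definition wronskian :: "(4 \<Rightarrow> 'k \<times> 'k \<Rightarrow> 'k::real_normed_field) \<Rightarrow> 'k \<times> 'k \<Rightarrow> 'k ^ 4 ^ 4" where
  "wronskian z p = (\<chi> j i. frame (z i) p $ j)"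

definition lincomb :: "'k ^ 4 \<Rightarrow> (4 \<Rightarrow> 'a \<Rightarrow> 'k::field) \<Rightarrow> 'a \<Rightarrow> 'k" where
  "lincomb a z p = (\<Sum>i\<in>UNIV. a $ i * z i p)"

text \<open>
  The partial derivatives of the frame of a solution are linear in the frame: these are the
  coefficient matrices, obtained by differentiating \<open>z\<^sub>x\<^sub>x\<close> by \<open>y\<close> and \<open>z\<^sub>y\<^sub>y\<close> by \<open>x\<close>.
\<close>

definition connection_x ::
  "('k \<times> 'k \<Rightarrow> 'k) \<Rightarrow> ('k \<times> 'k \<Rightarrow> 'k) \<Rightarrow> ('k \<times> 'k \<Rightarrow> 'k) \<Rightarrow> ('k \<times> 'k \<Rightarrow> 'k) \<Rightarrow>
   'k \<times> 'k \<Rightarrow> 'k::real_normed_field ^ 4 ^ 4" where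
  "connection_x b \<mu> c \<nu> p = vector [vector [0, 1, 0, 0], vector [\<mu> p, 0, b p, 0], vector [0, 0, 0, 1],
     vector [pdy \<mu> p + b p * \<nu> p, b p * c p, pdy b p + \<mu> p, 0]]"

definition connection_y ::
  "('k \<times> 'k \<Rightarrow> 'k) \<Rightarrow> ('k \<times> 'k \<Rightarrow> 'k) \<Rightarrow> ('k \<times> 'k \<Rightarrow> 'k) \<Rightarrow> ('k \<times> 'k \<Rightarrow> 'k) \<Rightarrow>
   'k \<times> 'k \<Rightarrow> 'k::real_normed_field ^ 4 ^ 4" where
  "connection_y b \<mu> c \<nu> p = vector [vector [0, 0, 1, 0], vector [0, 0, 0, 1], vector [\<nu> p, c p, 0, 0],
     vector [pdx \<nu> p + c p * \<mu> p, pdx c p + \<nu> p, b p * c p, 0]]"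

lemma smooth2_on_lincomb:
  "open U \<Longrightarrow> (\<And>i. smooth2_on U (z i)) \<Longrightarrow> smooth2_on U (lincomb a z)"
  unfolding lincomb_def by (intro smooth2_on_sum smooth2_on_mult smooth2_on_const)

lemma has_partials_on_lincomb:
  assumes "\<And>i. has_partials_on U (z i) (zx i) (zy i)"
  shows "has_partials_on U (lincomb a z) (lincomb a zx) (lincomb a zy)"
  using assms unfolding has_partials_on_def lincomb_def
  by (auto intro!: continuous_on_sum continuous_on_mult DERIV_sum DERIV_cmult)

lemma pdx_lincomb:
    "(\<And>i. smooth2_on U (z i)) \<Longrightarrow> p \<in> U \<Longrightarrow> pdx (lincomb a z) p = lincomb a (\<lambda>i. pdx (z i)) p"
  and pdy_lincomb:
    "(\<And>i. smooth2_on U (z i)) \<Longrightarrow> p \<in> U \<Longrightarrow> pdy (lincomb a z) p = lincomb a (\<lambda>i. pdy (z i)) p"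
  by (rule has_partials_on_pdx[OF has_partials_on_lincomb[OF smooth2_onD(1)]]
      has_partials_on_pdy[OF has_partials_on_lincomb[OF smooth2_onD(1)]]; assumption)+

lemma frame_lincomb:
  assumes "open U" "\<And>i. smooth2_on U (z i)" "p \<in> U"
  shows "frame (lincomb a z) p = wronskian z p *v a"
proof -
  note d = pdx_lincomb pdy_lincomb
  have "pdy (pdx (lincomb a z)) p = pdy (lincomb a (\<lambda>i. pdx (z i))) p"
    using d(1)[of U z] assms by (intro pdy_cong[OF assms(1,3)]) auto
  also have "\<dots> = lincomb a (\<lambda>i. pdy (pdx (z i))) p"
    using assms by (intro d) (auto intro: smooth2_onD)
  finally show ?thesis
    using d[of U z p] assms(2,3)
    by (simp add: vec_eq_iff forall_4 frame_def wronskian_def matrix_vector_mult_def lincomb_def mult.commute)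
qed

lemma solves_lincomb:
  assumes "open U" "\<And>i. solves b \<mu> c \<nu> U (z i)"
  shows "solves b \<mu> c \<nu> U (lincomb a z)"
proof -
  have sm: "smooth2_on U (z i)" for i using assms(2) by (simp add: solves_def)
  note d = pdx_lincomb pdy_lincomb
  have "pdx (pdx (lincomb a z)) p = lincomb a (\<lambda>i. pdx (pdx (z i))) p"
       "pdy (pdy (lincomb a z)) p = lincomb a (\<lambda>i. pdy (pdy (z i))) p" if "p \<in> U" for p
  proof -
    have "pdx (pdx (lincomb a z)) p = pdx (lincomb a (\<lambda>i. pdx (z i))) p"
      using d(1)[of U z] sm by (intro pdx_cong[OF assms(1) that]) auto
    also have "\<dots> = lincomb a (\<lambda>i. pdx (pdx (z i))) p"
      using sm that by (intro d) (auto intro: smooth2_onD)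
    finally show "pdx (pdx (lincomb a z)) p = lincomb a (\<lambda>i. pdx (pdx (z i))) p" .
    have "pdy (pdy (lincomb a z)) p = pdy (lincomb a (\<lambda>i. pdy (z i))) p"
      using d(2)[of U z] sm by (intro pdy_cong[OF assms(1) that]) auto
    also have "\<dots> = lincomb a (\<lambda>i. pdy (pdy (z i))) p"
      using sm that by (intro d) (auto intro: smooth2_onD)
    finally show "pdy (pdy (lincomb a z)) p = lincomb a (\<lambda>i. pdy (pdy (z i))) p" .
  qed
  then show ?thesis
    using assms(2) d[of U z] sm smooth2_on_lincomb[OF assms(1) sm]
    unfolding solves_def by (simp add: lincomb_def algebra_simps sum.distrib sum_distrib_left)
qed

lemma bounded_linear_axis: "bounded_linear (axis j :: 'a::real_normed_vector \<Rightarrow> 'a ^ 'n)"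
proof (rule bounded_linear_intro[where K = 1])
  show "norm (axis j x :: 'a ^ 'n) \<le> norm x * 1" for x
  proof -
    have "norm (axis j x :: 'a ^ 'n) \<le> (\<Sum>i\<in>UNIV. norm ((axis j x :: 'a ^ 'n) $ i))"
      by (simp add: norm_vec_def L2_set_le_sum)
    also have "\<dots> = norm x"
      by (simp add: axis_def if_distrib cong: if_cong)
    finally show ?thesis by simp
  qed
qed (simp_all add: vec_eq_iff axis_def)

locale linear_system =
  fixes b \<mu> c \<nu> :: "'k \<times> 'k \<Rightarrow> 'k::{real_normed_field,euclidean_space}" and U :: "('k \<times> 'k) set"
  assumes open_domain: "open U" and convex_domain: "convex U"
    and smooth_coeffs: "smooth2_on U b" "smooth2_on U \<mu>" "smooth2_on U c" "smooth2_on U \<nu>"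
begin

lemma partials_frame:
  assumes z: "solves b \<mu> c \<nu> U z" and p: "p \<in> U"
  shows "pdx (\<lambda>p. frame z p $ j) p = (connection_x b \<mu> c \<nu> p *v frame z p) $ j"
    and "pdy (\<lambda>p. frame z p $ j) p = (connection_y b \<mu> c \<nu> p *v frame z p) $ j"
proof -
  have zs: "smooth2_on U z" using z by (simp add: solves_def)
  note Dz = smooth2_onD[OF zs]
  have zxx: "pdx (pdx z) q = b q * pdy z q + \<mu> q * z q"
    and zyy: "pdy (pdy z) q = c q * pdx z q + \<nu> q * z q" if "q \<in> U" for q
    using z that by (auto simp: solves_def)
  have "pdx (pdy (pdx z)) p = pdy (pdx (pdx z)) p"
    by (rule pdx_pdy_commute[OF open_domain Dz(2) p])
  also have "\<dots> = pdy (\<lambda>q. b q * pdy z q + \<mu> q * z q) p"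
    using zxx by (intro pdy_cong[OF open_domain p]) auto
  also have "\<dots> = (pdy b p * pdy z p + b p * pdy (pdy z) p) + (pdy \<mu> p * z p + \<mu> p * pdy z p)"
    by (rule has_partials_on_pdy[OF has_partials_on_add[OF
          has_partials_on_mult[OF smooth2_onD(1)[OF smooth_coeffs(1)] smooth2_onD(1)[OF Dz(3)]]
          has_partials_on_mult[OF smooth2_onD(1)[OF smooth_coeffs(2)] Dz(1)]] p])
  finally have zxyx: "pdx (pdy (pdx z)) p = pdy b p * pdy z p + b p * pdy (pdy z) p + (pdy \<mu> p * z p + \<mu> p * pdy z p)" .
  have "pdy (pdy (pdx z)) p = pdy (pdx (pdy z)) p"
    using pdx_pdy_commute[OF open_domain zs] by (intro pdy_cong[OF open_domain p]) auto
  also have "\<dots> = pdx (pdy (pdy z)) p"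
    by (rule pdx_pdy_commute[OF open_domain Dz(3) p, symmetric])
  also have "\<dots> = pdx (\<lambda>q. c q * pdx z q + \<nu> q * z q) p"
    using zyy by (intro pdx_cong[OF open_domain p]) auto
  also have "\<dots> = (pdx c p * pdx z p + c p * pdx (pdx z) p) + (pdx \<nu> p * z p + \<nu> p * pdx z p)"
    by (rule has_partials_on_pdx[OF has_partials_on_add[OF
          has_partials_on_mult[OF smooth2_onD(1)[OF smooth_coeffs(3)] smooth2_onD(1)[OF Dz(2)]]
          has_partials_on_mult[OF smooth2_onD(1)[OF smooth_coeffs(4)] Dz(1)]] p])
  finally have zxyy: "pdy (pdy (pdx z)) p = pdx c p * pdx z p + c p * pdx (pdx z) p + (pdx \<nu> p * z p + \<nu> p * pdx z p)" .
  have "\<forall>j. pdx (\<lambda>p. frame z p $ j) p = (connection_x b \<mu> c \<nu> p *v frame z p) $ j"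
    unfolding forall_4 frame_def
    by (simp add: matrix_vector_mult_def sum_4 connection_x_def zxx[OF p] zyy[OF p] zxyx
        pdx_pdy_commute[OF open_domain zs p] algebra_simps)
  then show "pdx (\<lambda>p. frame z p $ j) p = (connection_x b \<mu> c \<nu> p *v frame z p) $ j" ..
  have "\<forall>j. pdy (\<lambda>p. frame z p $ j) p = (connection_y b \<mu> c \<nu> p *v frame z p) $ j"
    unfolding forall_4 frame_def
    by (simp add: matrix_vector_mult_def sum_4 connection_y_def zxx[OF p] zyy[OF p] zxyy algebra_simps)
  then show "pdy (\<lambda>p. frame z p $ j) p = (connection_y b \<mu> c \<nu> p *v frame z p) $ j" ..
qed

text \<open>The coefficient matrix of the equation that frames satisfy along a line with direction \<open>v\<close>.\<close>

definition connection :: "'k \<times> 'k \<Rightarrow> 'k \<times> 'k \<Rightarrow> 'k ^ 4 ^ 4" where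
  "connection v p = (\<chi> i j. fst v * connection_x b \<mu> c \<nu> p $ i $ j + snd v * connection_y b \<mu> c \<nu> p $ i $ j)"

lemma trace_connection: "trace (connection v p) = 0"
  by (simp add: trace_def sum_4 connection_def connection_x_def connection_y_def)

lemma continuous_on_connection: "continuous_on U (connection v)"
proof -
  have "\<forall>i j. smooth2_on U (\<lambda>p. connection_x b \<mu> c \<nu> p $ i $ j)"
    unfolding forall_4 connection_x_def 
    by simp (intro conjI smooth_coeffs smooth2_on_add smooth2_on_mult smooth2_on_const smooth2_onD open_domain)
  moreover have "\<forall>i j. smooth2_on U (\<lambda>p. connection_y b \<mu> c \<nu> p $ i $ j)"
    unfolding forall_4 connection_y_def 
    by simp (intro conjI smooth_coeffs smooth2_on_add smooth2_on_mult smooth2_on_const smooth2_onD open_domain)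
  ultimately show ?thesis
    unfolding connection_def
    by (intro continuous_on_vec_lambda continuous_on_add continuous_on_mult continuous_on_const smooth2_on_continuous)
      auto
qed

lemma frame_along_line:
  assumes z: "solves b \<mu> c \<nu> U z" and p: "p + t *\<^sub>R v \<in> U"
  shows "((\<lambda>t. frame z (p + t *\<^sub>R v) $ j) has_vector_derivative
      (connection v (p + t *\<^sub>R v) *v frame z (p + t *\<^sub>R v)) $ j) (at t within S)"
proof -
  have zs: "smooth2_on U z" using z by (simp add: solves_def)
  let ?q = "p + t *\<^sub>R v" and ?f = "\<lambda>p. frame z p $ j"
  have "((\<lambda>t. p + t *\<^sub>R v) has_derivative (\<lambda>h. h *\<^sub>R v)) (at t within S)"
    by (auto intro!: derivative_eq_intros)
  from has_derivative_compose[OF this smooth2_on_has_derivative[OF open_domain smooth2_on_frame[OF zs] p], of j]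
  have "((\<lambda>t. ?f (p + t *\<^sub>R v)) has_derivative (\<lambda>h. h *\<^sub>R (pdx ?f ?q * fst v + pdy ?f ?q * snd v))) (at t within S)"
    by (rule has_derivative_eq_rhs) (simp add: scaleR_add_right)
  moreover have "pdx ?f ?q * fst v + pdy ?f ?q * snd v = (connection v ?q *v frame z ?q) $ j"
    unfolding partials_frame[OF z p] connection_def matrix_vector_mult_def
    by (simp add: sum_distrib_left sum_distrib_right sum.distrib algebra_simps)
  ultimately show ?thesis by (simp add: has_vector_derivative_def)
qed

text \<open>Frames obey a linear differential equation along segments, so a frame that vanishes at one point
  vanishes everywhere.\<close>

lemma solution_unique:
  assumes z: "solves b \<mu> c \<nu> U z" and p: "p \<in> U" "frame z p = 0" and q: "q \<in> U"
  shows "z q = 0"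
proof -
  define v where "v = q - p"
  have seg: "p + t *\<^sub>R v \<in> U" if "t \<in> {0..1}" for t
    using convexD_alt[OF convex_domain p(1) q, of t] that by (simp add: v_def algebra_simps)
  have "compact ((\<lambda>t. connection v (p + t *\<^sub>R v)) ` {0..1})"
    using seg by (intro compact_continuous_image continuous_on_compose2[OF continuous_on_connection]
        continuous_intros) auto
  then have "bounded ((\<lambda>t. connection v (p + t *\<^sub>R v)) ` {0..1})"
    by (rule compact_imp_bounded)
  then obtain K where "\<forall>t\<in>{0..1}. norm (connection v (p + t *\<^sub>R v)) \<le> K"
    by (auto simp: bounded_iff)
  note K = this[rule_format]
  have "frame z (p + 1 *\<^sub>R v) = 0"
  proof (rule linear_growth_zero[where Z = "\<lambda>t. frame z (p + t *\<^sub>R v)"])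
    fix t :: real assume t: "t \<in> {0..1}"
    have "((\<lambda>t. \<Sum>j\<in>UNIV. axis j (frame z (p + t *\<^sub>R v) $ j)) has_vector_derivative
        (\<Sum>j\<in>UNIV. axis j ((connection v (p + t *\<^sub>R v) *v frame z (p + t *\<^sub>R v)) $ j))) (at t within {0..1})"
      by (intro has_vector_derivative_sum bounded_linear.has_vector_derivative[OF bounded_linear_axis]
          frame_along_line[OF z seg[OF t]])
    moreover have sumax: "(\<Sum>j\<in>UNIV. axis j (x $ j)) = x" for x :: "'k ^ 4"
      by (simp add: vec_eq_iff axis_def if_distrib cong: if_cong)
    ultimately show "((\<lambda>t. frame z (p + t *\<^sub>R v)) has_vector_derivative
        connection v (p + t *\<^sub>R v) *v frame z (p + t *\<^sub>R v)) (at t within {0..1})" by simp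
    have "norm (connection v (p + t *\<^sub>R v) $ i $ j) \<le> K" for i j
      using K[OF t] order_trans[OF Finite_Cartesian_Product.norm_nth_le Finite_Cartesian_Product.norm_nth_le]
        order_trans by blast
    then show "norm (connection v (p + t *\<^sub>R v) *v frame z (p + t *\<^sub>R v))
        \<le> (of_nat CARD(4) * (of_nat CARD(4) * K)) * norm (frame z (p + t *\<^sub>R v))"
      by (rule norm_matrix_vector_mult_le)
  qed (simp add: p(2))
  then have "frame z q $ 1 = 0" by (simp add: v_def)
  then show ?thesis by (simp add: frame_def)
qed

text \<open>Liouville's formula along segments, with vanishing trace.\<close>

lemma det_wronskian_constant:
  assumes z: "\<And>i. solves b \<mu> c \<nu> U (z i)" and p: "p \<in> U" and q: "q \<in> U"
  shows "det (wronskian z p) = det (wronskian z q)"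
proof -
  define v where "v = q - p"
  let ?W = "\<lambda>t. wronskian z (p + t *\<^sub>R v)"
  have seg: "p + t *\<^sub>R v \<in> U" if "t \<in> {0..1}" for t
    using convexD_alt[OF convex_domain p q, of t] that by (simp add: v_def algebra_simps)
  have "((\<lambda>t. det (?W t)) has_vector_derivative 0) (at t within {0..1})" if t: "t \<in> {0..1}" for t
  proof -
    have "((\<lambda>t. ?W t $ i $ j) has_vector_derivative (connection v (p + t *\<^sub>R v) ** ?W t) $ i $ j) (at t within {0..1})"
      for i j
      using frame_along_line[OF z seg[OF t], of j i]
      by (simp add: wronskian_def matrix_matrix_mult_def matrix_vector_mult_def)
    from has_vector_derivative_det[where M = ?W and A = "connection v (p + t *\<^sub>R v)", OF this] show ?thesis
      by (simp add: trace_connection)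
  qed
  from has_vector_derivative_zero_constant[OF convex_real_interval(5) this]
  obtain d where "\<And>t. t \<in> {0..1} \<Longrightarrow> det (?W t) = d" by metis
  from this[of 0] this[of 1] show ?thesis by (simp add: v_def)
qed

end

section \<open>Bases of solution spaces\<close>

interpretation fsc: vector_space "fscale :: 'k::field \<Rightarrow> ('a \<Rightarrow> 'k) \<Rightarrow> 'a \<Rightarrow> 'k"
  by (rule vector_space_fscale)

lemma sum_fun_apply: "(\<Sum>i\<in>A. f i) p = (\<Sum>i\<in>A. f i p :: 'k::comm_monoid_add)"
  by (induction A rule: infinite_finite_induct) auto

lemma lincomb_eq_sum_fscale: "lincomb a z = (\<Sum>i\<in>UNIV. fscale (a $ i) (z i))"
  by (simp add: fun_eq_iff lincomb_def sum_fun_apply fscale_def)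

lemma basis4_independent:
  assumes "is_basis4 z V" "lincomb a z = (\<lambda>_. 0)"
  shows "a = 0"
proof -
  have inj: "inj z" and ind: "\<not> fsc.dependent (range z)"
    using assms(1) by (auto simp: is_basis4_def)
  have "(\<Sum>f\<in>range z. fscale (a $ inv z f) f) = lincomb a z"
    by (simp add: sum.reindex[OF inj] lincomb_eq_sum_fscale inv_f_f[OF inj])
  then have "(\<Sum>f\<in>range z. fscale (a $ inv z f) f) = 0"
    using assms(2) by (simp add: zero_fun_def)
  then have "a $ inv z (z i) = 0" for i
    by (intro fsc.independentD[OF ind]) auto
  then show ?thesis by (simp add: vec_eq_iff inv_f_f[OF inj])
qed

lemma basis4_span:
  assumes "is_basis4 z V"
  shows "f \<in> V \<longleftrightarrow> (\<exists>a. f = lincomb a z)"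
proof -
  have inj: "inj z" and V: "V = range (\<lambda>u. \<Sum>g\<in>range z. fscale (u g) g)"
    using assms fsc.span_finite[of "range z"] by (auto simp: is_basis4_def)
  have expand: "(\<Sum>g\<in>range z. fscale (u g) g) = lincomb (\<chi> i. u (z i)) z" for u
    by (simp add: sum.reindex[OF inj] lincomb_eq_sum_fscale)
  have collect: "lincomb a z = (\<Sum>g\<in>range z. fscale (a $ inv z g) g)" for a
    by (simp add: sum.reindex[OF inj] lincomb_eq_sum_fscale inv_f_f[OF inj])
  show ?thesis
  proof
    assume "f \<in> V"
    then obtain u where "f = (\<Sum>g\<in>range z. fscale (u g) g)" unfolding V by blast
    then show "\<exists>a. f = lincomb a z" unfolding expand by blast
  next
    assume "\<exists>a. f = lincomb a z"
    then obtain a where f: "f = lincomb a z" ..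
    show "f \<in> V" unfolding V f by (rule range_eqI[where x = "\<lambda>g. a $ inv z g"]) (rule collect)
  qed
qed

lemma basis4_mem:
  assumes "is_basis4 z V" shows "z i \<in> V"
proof -
  have "z i = lincomb (axis i 1) z"
    by (simp add: fun_eq_iff lincomb_def axis_def if_distrib[of "\<lambda>x. x * _"] cong: if_cong)
  then show ?thesis using basis4_span[OF assms] by blast
qed

lemma is_basis4I:
  fixes z :: "4 \<Rightarrow> 'a \<Rightarrow> 'k::field"
  assumes ind: "\<And>a. lincomb a z = (\<lambda>_. 0) \<Longrightarrow> a = 0"
    and span: "\<And>f. f \<in> V \<longleftrightarrow> (\<exists>a. f = lincomb a z)"
  shows "is_basis4 z V"
proof -
  have inj: "inj z"
  proof (rule injI, rule ccontr)
    fix i j assume ij: "z i = z j" "i \<noteq> j"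
    have "lincomb (axis i 1 - axis j 1) z = (\<lambda>_. 0)"
      using ij(1) by (simp add: fun_eq_iff lincomb_def axis_def left_diff_distrib sum_subtractf
          if_distrib[of "\<lambda>x. x * _"] cong: if_cong)
    from ind[OF this] have "(axis i 1 - axis j 1 :: 'k ^ 4) $ i = 0" by simp
    then show False using ij(2) by (simp add: axis_def)
  qed
  have eq: "(\<Sum>g\<in>range z. fscale (u g) g) = lincomb (\<chi> i. u (z i)) z" for u
    by (simp add: sum.reindex[OF inj] lincomb_eq_sum_fscale)
  have "\<not> fsc.dependent (range z)"
  proof
    assume "fsc.dependent (range z)"
    then obtain u g where u: "g \<in> range z" "u g \<noteq> 0" "(\<Sum>g\<in>range z. fscale (u g) g) = 0"
      using fsc.dependent_finite[of "range z"] by auto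
    then have "(\<chi> i. u (z i)) = 0"
      using ind[of "\<chi> i. u (z i)"] eq[of u] by (simp add: zero_fun_def)
    then show False using u by (auto simp: vec_eq_iff)
  qed
  moreover have "lincomb a z = (\<Sum>g\<in>range z. fscale (a $ inv z g) g)" for a
    by (simp add: sum.reindex[OF inj] lincomb_eq_sum_fscale inv_f_f[OF inj])
  then have "f \<in> fsc.span (range z) \<longleftrightarrow> f \<in> V" for f
    unfolding fsc.span_finite[OF finite_imageI[OF finite]] span image_iff by (metis UNIV_I eq)
  then have "fsc.span (range z) = V" by blast
  ultimately show ?thesis using inj by (simp add: is_basis4_def)
qed

lemma dim_eq_4_of_basis4:
  assumes "is_basis4 z V" shows "vector_space.dim fscale V = 4"
proof -
  have ind: "\<not> fsc.dependent (range z)" and V: "V = fsc.span (range z)"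
    using assms by (simp_all add: is_basis4_def)
  have "fsc.span (range z) = fsc.span V"
    unfolding V by (rule fsc.span_span[symmetric])
  with ind have "fsc.dim V = card (range z)"
    by (intro fsc.dim_eq_card)
  then show ?thesis using assms by (simp add: is_basis4_def card_image)
qed

lemma singular_matrix_kernel:
  fixes A :: "'k::field^'n^'n"
  assumes "det A = 0" obtains v where "v \<noteq> 0" "A *v v = 0"
  using assms matrix_left_invertible_ker[of A] invertible_left_inverse[of A] invertible_det_nz[of A]
  by blast

context linear_system
begin

text \<open>A linear relation between the frames at one point spreads, by uniqueness, to a linear relation
  between the solutions.\<close>

lemma wronskian_basis_nonzero:
  assumes "is_basis4 z (solution_space b \<mu> c \<nu> U)" "p \<in> U"
  shows "det (wronskian z p) \<noteq> 0"
proof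
  assume "det (wronskian z p) = 0"
  then obtain a where a: "a \<noteq> 0" "wronskian z p *v a = 0" by (rule singular_matrix_kernel)
  have z: "solves b \<mu> c \<nu> U (z i)" "q \<notin> U \<Longrightarrow> z i q = 0" for i q
    using basis4_mem[OF assms(1), of i] unfolding mem_solution_space_iff by blast+
  have "frame (lincomb a z) p = 0"
    using z(1) a(2) assms(2) by (subst frame_lincomb[OF open_domain]) (auto simp: solves_def)
  then have "lincomb a z q = 0" if "q \<in> U" for q
    using solution_unique[OF solves_lincomb[OF open_domain z(1)] assms(2) _ that] by simp
  moreover have "lincomb a z q = 0" if "q \<notin> U" for q
    using z(2)[OF that] by (simp add: lincomb_def)
  ultimately have "lincomb a z = (\<lambda>_. 0)" by blast
  with basis4_independent[OF assms(1)] a(1) show False by blast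
qed

lemma frame_cong:
  assumes "p \<in> U" "\<And>q. q \<in> U \<Longrightarrow> z q = w q"
  shows "frame z p = frame w p"
proof -
  have "pdx z q = pdx w q" if "q \<in> U" for q
    using assms(2) that by (intro pdx_cong[OF open_domain])
  then show ?thesis
    using assms pdy_cong[OF open_domain assms(1), of z w] pdy_cong[OF open_domain assms(1), of "pdx z" "pdx w"]
    by (simp add: frame_def)
qed

lemma solves_cong:
  assumes "solves b \<mu> c \<nu> U z" "\<And>q. q \<in> U \<Longrightarrow> z q = w q"
  shows "solves b \<mu> c \<nu> U w"
proof -
  have first: "pdx z q = pdx w q" "pdy z q = pdy w q" if "q \<in> U" for q
    using assms(2) pdx_cong[OF open_domain that, of z w] pdy_cong[OF open_domain that, of z w] by auto
  have "pdx (pdx z) q = pdx (pdx w) q" "pdy (pdy z) q = pdy (pdy w) q" if "q \<in> U" for q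
    using first pdx_cong[OF open_domain that] pdy_cong[OF open_domain that] by blast+
  then show ?thesis
    using assms first smooth2_on_cong[OF open_domain assms(2)] unfolding solves_def by auto
qed

text \<open>A solution and the combination of the \<open>e\<^sub>i\<close> with the same frame at \<open>p\<close> coincide.\<close>

lemma basis_of_wronskian_nonzero:
  assumes e: "\<And>i. solves b \<mu> c \<nu> U (e i)" and p: "p \<in> U" and det: "det (wronskian e p) \<noteq> 0"
  shows "is_basis4 (\<lambda>i q. if q \<in> U then e i q else 0) (solution_space b \<mu> c \<nu> U)" (is "is_basis4 ?e ?V")
proof (rule is_basis4I)
  have eU: "lincomb a ?e q = (if q \<in> U then lincomb a e q else 0)" for a q
    by (simp add: lincomb_def)
  have es: "smooth2_on U (e i)" for i using e by (simp add: solves_def)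
  have inv: "invertible (wronskian e p)" using det by (simp add: invertible_det_nz)
  fix a assume "lincomb a ?e = (\<lambda>_. 0)"
  then have "lincomb a e q = 0" if "q \<in> U" for q using eU[of a q] that by simp
  then have "frame (lincomb a e) p = frame (\<lambda>_. 0) p" by (intro frame_cong p) auto
  then have "wronskian e p *v a = 0"
    using frame_lincomb[OF open_domain es p, of a]
    by (simp add: frame_def pdx_def pdy_def vec_eq_iff forall_4)
  then show "a = 0"
    using inv matrix_left_invertible_ker[of "wronskian e p"] invertible_left_inverse by blast
next
  have eU: "lincomb a ?e q = (if q \<in> U then lincomb a e q else 0)" for a q
    by (simp add: lincomb_def)
  have es: "smooth2_on U (e i)" for i using e by (simp add: solves_def)
  have lin: "solves b \<mu> c \<nu> U (lincomb a e)" for a by (rule solves_lincomb[OF open_domain e])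
  fix f
  show "f \<in> ?V \<longleftrightarrow> (\<exists>a. f = lincomb a ?e)"
  proof
    assume f: "f \<in> ?V"
    then have fs: "solves b \<mu> c \<nu> U f" by (simp add: mem_solution_space_iff)
    have "surj ((*v) (wronskian e p))"
      using det invertible_det_nz invertible_right_inverse matrix_right_invertible_surjective by blast
    then obtain a where a: "frame f p = wronskian e p *v a" by (metis surjD)
    \<comment> \<open>\<open>f - lincomb a e\<close>, written as a combination of four solutions\<close>
    define g where "g i = (if i = 1 then f else if i = 2 then lincomb a e else (\<lambda>_. 0))" for i :: 4
    define d :: "'k ^ 4" where "d = vector [1, -1, 0, 0]"
    have zero: "solves b \<mu> c \<nu> U (\<lambda>_. 0)"
      using lin[of 0] by (simp add: lincomb_def[abs_def])
    have "solves b \<mu> c \<nu> U (g i)" for i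
      using fs lin zero by (simp add: g_def)
    note gs = this
    have gsm: "smooth2_on U (g i)" for i using gs by (simp add: solves_def)
    have "frame (lincomb d g) p = 0"
      unfolding frame_lincomb[OF open_domain gsm p]
      using a frame_lincomb[OF open_domain es p, of a]
      by (simp add: vec_eq_iff matrix_vector_mult_def sum_4 d_def wronskian_def g_def)
    from solution_unique[OF solves_lincomb[OF open_domain gs] p this]
    have "lincomb d g q = 0" if "q \<in> U" for q using that by blast
    then have "f q = lincomb a e q" if "q \<in> U" for q
      using that unfolding lincomb_def[of d] by (simp add: sum_4 d_def g_def)
    then have "f = lincomb a ?e"
      using f eU by (auto simp: fun_eq_iff mem_solution_space_iff)
    then show "\<exists>a. f = lincomb a ?e" ..
  next
    assume "\<exists>a. f = lincomb a ?e"
    then obtain a where f: "f = lincomb a ?e" ..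
    show "f \<in> ?V"
      using solves_cong[OF lin, of a f] by (auto simp: mem_solution_space_iff f eU)
  qed
qed

end

section \<open>The surface of a fundamental system of solutions\<close>

abbreviation lift_of :: "(4 \<Rightarrow> 'a \<Rightarrow> 'k) \<Rightarrow> 'a \<Rightarrow> 'k ^ 4" where
  "lift_of z q \<equiv> \<chi> i. z i q"

lemma vdx_lift_of: "vdx (lift_of z) = lift_of (\<lambda>i. pdx (z i))"
  and vdy_lift_of: "vdy (lift_of z) = lift_of (\<lambda>i. pdy (z i))"
  by (simp_all add: vdx_def vdy_def fun_eq_iff vec_eq_iff)

lemma wronskian_eq_vector:
  "wronskian z p = vector [lift_of z p, vdx (lift_of z) p, vdy (lift_of z) p, vdy (vdx (lift_of z)) p]"
  unfolding vec_eq_iff[of "wronskian z p"] forall_4 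
  by (simp add: vec_eq_iff wronskian_def frame_def vdx_lift_of vdy_lift_of)

lemma det_vector_4_last_row:
  fixes r1 r2 r3 r4 :: "'k::field ^ 4"
  shows "det (vector [r1, r2, r3, a *s r4 + (a1 *s r1 + a2 *s r2 + a3 *s r3)] :: 'k ^ 4 ^ 4)
    = a * det (vector [r1, r2, r3, r4] :: 'k ^ 4 ^ 4)"
proof -
  let ?A = "vector [r1, r2, r3, a *s r4] :: 'k ^ 4 ^ 4" and ?B = "vector [r1, r2, r3, r4] :: 'k ^ 4 ^ 4"
  let ?x = "a1 *s r1 + a2 *s r2 + a3 *s r3"
  have rows: "row 1 ?A = r1" "row 2 ?A = r2" "row 3 ?A = r3" "row 4 ?A = a *s r4"
    by (simp_all add: row_def vec_eq_iff)
  have "r1 \<in> {row j ?A | j. j \<noteq> 4}" "r2 \<in> {row j ?A | j. j \<noteq> 4}" "r3 \<in> {row j ?A | j. j \<noteq> 4}"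
    using rows by (force intro: exI[of _ 1] exI[of _ 2] exI[of _ 3])+
  then have "?x \<in> vec.span {row j ?A | j. j \<noteq> 4}"
    by (intro vec.span_add vec.span_scale vec.span_base)
  from det_row_span[OF this] have "det (\<chi> k. if k = 4 then row 4 ?A + ?x else row k ?A) = det ?A" .
  also have "(\<chi> k. if k = 4 then row 4 ?A + ?x else row k ?A) = vector [r1, r2, r3, a *s r4 + ?x]"
    by (simp add: vec_eq_iff forall_4 rows)
  also have "?A = (\<chi> k. if k = 4 then a *s r4 else ?B $ k)" by (simp add: vec_eq_iff forall_4)
  also have "det \<dots> = a * det (\<chi> k. if k = 4 then r4 else ?B $ k)" by (rule det_row_mul)
  also have "(\<chi> k. if k = 4 then r4 else ?B $ k) = ?B" by (simp add: vec_eq_iff forall_4)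
  finally show ?thesis .
qed

lemma wronskian_rows_independent:
  assumes "det (wronskian z q) \<noteq> 0"
    and "a *s lift_of z q + b *s vdx (lift_of z) q + c *s vdy (lift_of z) q = 0"
  shows "a = 0 \<and> b = 0 \<and> c = 0"
proof -
  let ?T = "transpose (wronskian z q)"
  have "?T *v vector [a, b, c, 0] = 0"
    using assms(2) by (simp add: vec_eq_iff transpose_def matrix_vector_mult_def sum_4 wronskian_eq_vector mult.commute)
  moreover have "invertible ?T" using assms(1) by (simp add: invertible_det_nz)
  ultimately have "(vector [a, b, c, 0] :: 'a ^ 4) = 0"
    using matrix_left_invertible_ker[of ?T] invertible_left_inverse by blast
  then show ?thesis by (simp add: vec_eq_iff forall_4)
qed

lemma lift_nonzero_of_wronskian: "det (wronskian z q) \<noteq> 0 \<Longrightarrow> lift_of z q \<noteq> 0"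
  using wronskian_rows_independent[of z q 1 0 0] by auto

locale fundamental_system = linear_system b \<mu> c \<nu> U
  for b \<mu> c \<nu> :: "'k \<times> 'k \<Rightarrow> 'k::{real_normed_field,euclidean_space}" and U :: "('k \<times> 'k) set" +
  fixes z :: "4 \<Rightarrow> 'k \<times> 'k \<Rightarrow> 'k"
  assumes solutions: "solves b \<mu> c \<nu> U (z i)"
    and wronskian_nonzero: "p \<in> U \<Longrightarrow> det (wronskian z p) \<noteq> 0"
begin

lemma smooth_solutions: "smooth2_on U (z i)"
  using solutions by (simp add: solves_def)

lemma local_lift_solutions: "local_lift (map_of_functions z) U (lift_of z)"
  using open_domain smooth_solutions lift_nonzero_of_wronskian[OF wronskian_nonzero]
  by (simp add: local_lift_def map_of_functions_def)

lemma immersed: "U \<noteq> {} \<Longrightarrow> immersed_surface U (map_of_functions z)"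
  unfolding immersed_surface_def
  using open_domain local_lift_solutions wronskian_rows_independent[OF wronskian_nonzero] by blast

text \<open>The system expresses \<open>w\<^sub>x\<^sub>x\<close> and \<open>w\<^sub>y\<^sub>y\<close> by \<open>w, w\<^sub>x, w\<^sub>y\<close>, so only \<open>w\<^sub>x\<^sub>y\<close> contributes.\<close>

lemma second_ff_solutions:
  assumes p: "p \<in> U"
  shows "second_ff (lift_of z) p X Y = det (wronskian z p) * (fst X * snd Y + snd X * fst Y)"
proof -
  let ?w = "lift_of z"
  have "(fst X * fst Y) *s vdx (vdx ?w) p + (fst X * snd Y + snd X * fst Y) *s vdy (vdx ?w) p
        + (snd X * snd Y) *s vdy (vdy ?w) p
      = (fst X * snd Y + snd X * fst Y) *s vdy (vdx ?w) p + ((fst X * fst Y * \<mu> p + snd X * snd Y * \<nu> p) *s ?w p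
        + (snd X * snd Y * c p) *s vdx ?w p + (fst X * fst Y * b p) *s vdy ?w p)"
    using solutions p unfolding solves_def vdx_lift_of vdy_lift_of
    by (simp add: vec_eq_iff algebra_simps)
  then show ?thesis
    unfolding second_ff_def by (simp only: det_vector_4_last_row wronskian_eq_vector mult.commute)
qed

lemma asymptotic: "asymptotic_coordinates U (map_of_functions z)"
  unfolding asymptotic_coordinates_def 
proof
  fix p assume "p \<in> U"
  then show "\<exists>N w. p \<in> N \<and> local_lift (map_of_functions z) N w \<and>
      second_ff w p (1, 0) (1, 0) = 0 \<and> second_ff w p (0, 1) (0, 1) = 0"
    using local_lift_solutions by (intro exI[of _ U] exI[of _ "lift_of z"]) (simp add: second_ff_solutions)
qed

lemma conformal: "second_ff_conformal_dxdy U (map_of_functions z)"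
  unfolding second_ff_conformal_dxdy_def 
proof
  fix p assume p: "p \<in> U"
  show "\<exists>N w. p \<in> N \<and> local_lift (map_of_functions z) N w \<and>
      (\<exists>\<rho>. \<rho> \<noteq> 0 \<and> (\<forall>X Y. second_ff w p X Y = \<rho> * (fst X * snd Y + snd X * fst Y)))"
    using local_lift_solutions p wronskian_nonzero[OF p]
    by (intro exI[of _ U] exI[of _ "lift_of z"] conjI exI[of _ "det (wronskian z p)"] allI second_ff_solutions)
qed

end

section \<open>Systems with the same \<open>b\<close> and \<open>c\<close> define projective deformations\<close>

lemma proj_act_pt: "proj_act g (pt v) = pt (g *v v)"
proof -
  have "g *v (a *s v) = a *s (g *v v)" for a by (rule vec.scale)
  then show ?thesis unfolding proj_act_def pt_def by (auto simp: image_iff) metis+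
qed

lemma pt_scale: "r \<noteq> 0 \<Longrightarrow> pt (r *s v) = pt v"
proof -
  assume r: "r \<noteq> 0"
  have "a *s v = (a / r) *s (r *s v)" "a / r \<noteq> 0" "a *s (r *s v) = (a * r) *s v" "a * r \<noteq> 0" if "a \<noteq> 0" for a
    using r that by (simp_all add: vector_smult_assoc)
  then show "pt (r *s v) = pt v"
    unfolding pt_def by blast
qed

lemma mem_pt_self: "v \<in> pt v"
  unfolding pt_def by (auto intro: exI[of _ 1])

lemma derivatives_along_curve:
  fixes f :: "('k::real_normed_field \<times> 'k) \<Rightarrow> 'k"
  assumes "open U" "smooth2_on U f" "open S" "0 \<in> S" "\<And>t. t \<in> S \<Longrightarrow> (x t, y t) \<in> U"
    "smooth1_on S x" "smooth1_on S y"
  defines "p \<equiv> (x 0, y 0)" and "F \<equiv> \<lambda>t. f (x t, y t)"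
  shows "deriv F 0 = pdx f p * deriv x 0 + pdy f p * deriv y 0"
    and "deriv (deriv F) 0 = pdx (pdx f) p * (deriv x 0)\<^sup>2 + 2 * pdy (pdx f) p * deriv x 0 * deriv y 0
      + pdy (pdy f) p * (deriv y 0)\<^sup>2 + pdx f p * deriv (deriv x) 0 + pdy f p * deriv (deriv y) 0"
proof -
  have D1: "((\<lambda>t. h (x t, y t)) has_field_derivative
      pdx h (x t, y t) * deriv x t + pdy h (x t, y t) * deriv y t) (at t)"
    if "t \<in> S" "smooth2_on U h" for t h
    using that assms(5)
    by (intro has_field_derivative_along_curve[OF assms(1)] smooth1_onD[OF assms(6)] smooth1_onD[OF assms(7)])
  have first: "deriv F t = pdx f (x t, y t) * deriv x t + pdy f (x t, y t) * deriv y t" if "t \<in> S" for t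
    unfolding F_def by (rule DERIV_imp_deriv[OF D1[OF that assms(2)]])
  then show "deriv F 0 = pdx f p * deriv x 0 + pdy f p * deriv y 0"
    using assms(4) by (simp add: p_def)
  have "((\<lambda>t. pdx f (x t, y t) * deriv x t + pdy f (x t, y t) * deriv y t) has_field_derivative
      (pdx (pdx f) p * deriv x 0 + pdy (pdx f) p * deriv y 0) * deriv x 0 + deriv (deriv x) 0 * pdx f p
      + ((pdx (pdy f) p * deriv x 0 + pdy (pdy f) p * deriv y 0) * deriv y 0 + deriv (deriv y) 0 * pdy f p)) (at 0)"
    unfolding p_def
    by (intro DERIV_add DERIV_mult D1 assms(4) smooth2_onD[OF assms(2)] smooth1_onD(2)[OF assms(6)] smooth1_onD(2)[OF assms(7)])
  then have "deriv (\<lambda>t. pdx f (x t, y t) * deriv x t + pdy f (x t, y t) * deriv y t) 0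
      = (pdx (pdx f) p * deriv x 0 + pdy (pdx f) p * deriv y 0) * deriv x 0 + deriv (deriv x) 0 * pdx f p
      + ((pdx (pdy f) p * deriv x 0 + pdy (pdy f) p * deriv y 0) * deriv y 0 + deriv (deriv y) 0 * pdy f p)"
    by (rule DERIV_imp_deriv)
  moreover have "deriv (deriv F) 0 = deriv (\<lambda>t. pdx f (x t, y t) * deriv x t + pdy f (x t, y t) * deriv y t) 0"
    using first by (intro deriv_cong_open[OF assms(3,4)])
  moreover have "pdx (pdy f) p = pdy (pdx f) p"
    using pdx_pdy_commute[OF assms(1,2)] assms(4,5) by (simp add: p_def)
  ultimately show "deriv (deriv F) 0 = pdx (pdx f) p * (deriv x 0)\<^sup>2 + 2 * pdy (pdx f) p * deriv x 0 * deriv y 0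
      + pdy (pdy f) p * (deriv y 0)\<^sup>2 + pdx f p * deriv (deriv x) 0 + pdy f p * deriv (deriv y) 0"
    by (simp add: algebra_simps power2_eq_square)
qed

text \<open>A factor \<open>1 + k t\<^sup>2/2\<close> changes the 2-jet at \<open>0\<close> only by \<open>k\<close> times the value in the second derivative.\<close>

lemma derivatives_rescaled:
  fixes F :: "'k::real_normed_field \<Rightarrow> 'k" and k :: 'k
  assumes "open S" "0 \<in> S" "smooth1_on S F"
  defines "G \<equiv> \<lambda>t. (1 + k / 2 * (t * t)) * F t"
  shows "deriv G 0 = deriv F 0" and "deriv (deriv G) 0 = deriv (deriv F) 0 + k * F 0"
proof -
  have "(G has_field_derivative k * t * F t + (1 + k / 2 * (t * t)) * deriv F t) (at t)" if "t \<in> S" for t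
    unfolding G_def using smooth1_onD(1)[OF assms(3) that]
    by (auto intro!: derivative_eq_intros)
  then have first: "deriv G t = k * t * F t + (1 + k / 2 * (t * t)) * deriv F t" if "t \<in> S" for t
    using that DERIV_imp_deriv by blast
  then show "deriv G 0 = deriv F 0" using assms(2) by simp
  have "((\<lambda>t. k * t * F t + (1 + k / 2 * (t * t)) * deriv F t) has_field_derivative
      deriv (deriv F) 0 + k * F 0) (at 0)"
    using smooth1_onD[OF assms(3,2)] by (auto intro!: derivative_eq_intros)
  then have "deriv (\<lambda>t. k * t * F t + (1 + k / 2 * (t * t)) * deriv F t) 0 = deriv (deriv F) 0 + k * F 0"
    by (rule DERIV_imp_deriv)
  moreover have "deriv (deriv G) 0 = deriv (\<lambda>t. k * t * F t + (1 + k / 2 * (t * t)) * deriv F t) 0"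
    using first by (intro deriv_cong_open[OF assms(1,2)])
  ultimately show "deriv (deriv G) 0 = deriv (deriv F) 0 + k * F 0" by simp
qed

text \<open>
  If the frames of two solutions of systems with common \<open>b, c\<close> agree at \<open>p\<close>, the second derivatives
  along a curve differ by \<open>k\<close> times the common value at \<open>p\<close>, where \<open>k\<close> depends only on the curve and
  the potentials and so is the same for all components of the lifts.  One quadratic factor in the parameter
  absorbs it.
\<close>

lemma same_2jet_of_same_frame:
  fixes f h :: "('k::real_normed_field \<times> 'k) \<Rightarrow> 'k"
  assumes "open U" "solves b \<mu> c \<nu> U f" "solves b \<mu>' c \<nu>' U h"
    "open S" "0 \<in> S" "\<And>t. t \<in> S \<Longrightarrow> (x t, y t) \<in> U" "smooth1_on S x" "smooth1_on S y"
  defines "p \<equiv> (x 0, y 0)"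
  assumes "frame f p = frame h p"
    and "k = (\<mu> p - \<mu>' p) * (deriv x 0)\<^sup>2 + (\<nu> p - \<nu>' p) * (deriv y 0)\<^sup>2" and "n \<le> 2"
  shows "(deriv ^^ n) (\<lambda>t. f (x t, y t)) 0 = (deriv ^^ n) (\<lambda>t. (1 + k / 2 * (t * t)) * h (x t, y t)) 0"
proof -
  have sm: "smooth2_on U f" "smooth2_on U h" using assms(2,3) by (auto simp: solves_def)
  have p: "p \<in> U" unfolding p_def using assms(5,6) by blast
  have fr: "f p = h p" "pdx f p = pdx h p" "pdy f p = pdy h p" "pdy (pdx f) p = pdy (pdx h) p"
    using assms(10) by (simp_all add: frame_def vec_eq_iff forall_4)
  have hs: "smooth1_on S (\<lambda>t. h (x t, y t))"
    by (rule smooth1_on_compose[OF assms(1,4) sm(2) assms(6-8)])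
  note df = derivatives_along_curve[OF assms(1) sm(1) assms(4-8), folded p_def]
  note dh = derivatives_along_curve[OF assms(1) sm(2) assms(4-8), folded p_def]
  note dr = derivatives_rescaled[OF assms(4,5) hs, of k]
  consider "n = 0" | "n = 1" | "n = 2" using \<open>n \<le> 2\<close> by linarith
  then show ?thesis
  proof cases
    case 1 then show ?thesis using fr by (simp add: p_def)
  next
    case 2 then show ?thesis using fr df dh dr by simp
  next
    case 3
    have "pdx (pdx f) p = b p * pdy f p + \<mu> p * f p" "pdy (pdy f) p = c p * pdx f p + \<nu> p * f p"
         "pdx (pdx h) p = b p * pdy h p + \<mu>' p * h p" "pdy (pdy h) p = c p * pdx h p + \<nu>' p * h p"
      using assms(2,3) p by (auto simp: solves_def)
    then have "deriv (deriv (\<lambda>t. f (x t, y t))) 0 = deriv (deriv (\<lambda>t. h (x t, y t))) 0 + k * h p"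
      using fr df(2) dh(2) by (simp add: assms(11) algebra_simps power2_eq_square)
    then show ?thesis using dr(2) by (simp add: 3 numeral_2_eq_2 p_def)
  qed
qed

lemma wronskian_lincomb:
  assumes "open U" "\<And>i. smooth2_on U (z i)" "p \<in> U"
  shows "wronskian (\<lambda>i. lincomb (column i R) z) p = wronskian z p ** R"
proof -
  have "frame (lincomb (column i R) z) p $ j = (wronskian z p ** R) $ j $ i" for i j
    unfolding frame_lincomb[OF assms] by (simp add: column_def matrix_vector_mult_def matrix_matrix_mult_def)
  then show ?thesis by (simp add: wronskian_def[of "\<lambda>i. lincomb (column i R) z"] vec_eq_iff)
qed

text \<open>The transformation \<open>g\<close> at \<open>p\<close> carries the frame of \<open>u\<close> at \<open>p\<close> to the frame of \<open>w\<close> at \<open>p\<close>; equality of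
  the Wronskians makes its determinant 1.\<close>

lemma projective_deformation_of_same_bc:
  fixes u w :: "4 \<Rightarrow> 'k \<times> 'k \<Rightarrow> 'k::{real_normed_field,euclidean_space}"
  assumes "fundamental_system b \<mu> c \<nu> U u" "fundamental_system b \<mu>' c \<nu>' U w"
    and det: "\<And>p. p \<in> U \<Longrightarrow> det (wronskian u p) = det (wronskian w p)"
  shows "projective_deformation U (map_of_functions u) U (map_of_functions w) (\<lambda>p. p)"
proof -
  interpret u: fundamental_system b \<mu> c \<nu> U u by fact
  interpret w: fundamental_system b \<mu>' c \<nu>' U w by fact
  note op = u.open_domain
  have "\<exists>g :: 'k ^ 4 ^ 4. det g = 1 \<and> proj_act g (map_of_functions u p) = map_of_functions w p \<and>
        (\<forall>\<gamma>. curve_through U p \<gamma> \<longrightarrow>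
             second_order_contact (\<lambda>t. proj_act g (map_of_functions u (\<gamma> t))) (\<lambda>t. map_of_functions w (\<gamma> t)))"
    if p: "p \<in> U" for p
  proof -
    obtain R where R: "wronskian u p ** R = wronskian w p"
    proof -
      obtain B where "wronskian u p ** B = mat 1"
        using u.wronskian_nonzero[OF p] invertible_det_nz invertible_right_inverse by blast
      then show thesis using that[of "B ** wronskian w p"] by (simp add: matrix_mul_assoc)
    qed
    define g where "g = transpose R"
    have "det (wronskian u p) * det R = det (wronskian u p)"
      using R det[OF p] det_mul by metis
    then have detg: "det g = 1" using u.wronskian_nonzero[OF p] by (simp add: g_def)
    define f where "f i = lincomb (column i R) u" for i
    have f: "solves b \<mu> c \<nu> U (f i)" for i
      unfolding f_def by (rule solves_lincomb[OF op u.solutions])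
    have gu: "g *v lift_of u q = lift_of f q" for q
      by (simp add: vec_eq_iff f_def g_def lincomb_def matrix_vector_mult_def transpose_def column_def)
    have "wronskian f p = wronskian w p"
      unfolding f_def[abs_def] wronskian_lincomb[OF op u.smooth_solutions p] by (rule R)
    then have frf: "frame (f i) p = frame (w i) p" for i
      by (simp add: wronskian_def vec_eq_iff)
    have act: "proj_act g (map_of_functions u q) = pt (lift_of f q)" for q
      by (simp add: map_of_functions_def proj_act_pt gu)
    have fp: "f i p = w i p" for i
      using frf[of i] by (simp add: frame_def vec_eq_iff forall_4)
    have contact: "second_order_contact (\<lambda>t. proj_act g (map_of_functions u (\<gamma> t))) (\<lambda>t. map_of_functions w (\<gamma> t))"
      if "curve_through U p \<gamma>" for \<gamma>
    proof -
      define x y where "x = (\<lambda>t. fst (\<gamma> t))" and "y = (\<lambda>t. snd (\<gamma> t))"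
      have \<gamma>: "\<gamma> t = (x t, y t)" for t by (simp add: x_def y_def)
      have "\<exists>S. open S \<and> 0 \<in> S \<and> \<gamma> ` S \<subseteq> U \<and> smooth1_on S x \<and> smooth1_on S y"
        using that unfolding curve_through_def x_def y_def by (elim conjE)
      then obtain S where S: "open S" "0 \<in> S" "\<gamma> ` S \<subseteq> U" "smooth1_on S x" "smooth1_on S y"
        by blast
      have p0: "p = (x 0, y 0)"
        using that by (simp add: curve_through_def \<gamma>)
      define k where "k = (\<mu> p - \<mu>' p) * (deriv x 0)\<^sup>2 + (\<nu> p - \<nu>' p) * (deriv y 0)\<^sup>2"
      define \<rho> where "\<rho> t = 1 + k / 2 * (t * t)" for t
      define T where "T = S \<inter> {t. \<rho> t \<noteq> 0}"
      have "open T"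
        unfolding T_def \<rho>_def using S(1) by (intro open_Int open_Collect_neq continuous_intros) auto
      moreover have "0 \<in> T" using S(2) by (simp add: T_def \<rho>_def)
      ultimately have T: "open T" "0 \<in> T" "smooth1_on T x" "smooth1_on T y" "\<And>t. t \<in> T \<Longrightarrow> (x t, y t) \<in> U"
        using S(3-5) by (auto simp: T_def \<gamma> elim: smooth1_on_subset)
      have \<rho>s: "smooth1_on T \<rho>"
        unfolding \<rho>_def by (intro smooth1_on_add smooth1_on_mult smooth1_on_const smooth1_on_id T(1))
      have fs: "smooth1_on T (\<lambda>t. f i (x t, y t))" and ws: "smooth1_on T (\<lambda>t. w i (x t, y t))" for i
        using f[of i] w.smooth_solutions T
        by (auto intro!: smooth1_on_compose[OF op T(1)] simp: solves_def)
      have "lift_of f q \<noteq> 0" if "q \<in> U" for q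
      proof
        assume "lift_of f q = 0"
        then have "g *v lift_of u q = 0" by (simp add: gu)
        moreover have "invertible g" using detg by (simp add: invertible_det_nz)
        ultimately have "lift_of u q = 0"
          using matrix_left_invertible_ker[of g] invertible_left_inverse by blast
        then show False using lift_nonzero_of_wronskian[OF u.wronskian_nonzero[OF that]] by simp
      qed
      moreover have "\<rho> t *s lift_of w (\<gamma> t) \<noteq> 0" "map_of_functions w (\<gamma> t) = pt (\<rho> t *s lift_of w (\<gamma> t))" if "t \<in> T" for t
        using that lift_nonzero_of_wronskian[OF w.wronskian_nonzero[OF T(5)[OF that]]]
        by (auto simp: T_def \<gamma> map_of_functions_def pt_scale)
      moreover have "(deriv ^^ n) (\<lambda>t. lift_of f (\<gamma> t) $ i) 0 = (deriv ^^ n) (\<lambda>t. (\<rho> t *s lift_of w (\<gamma> t)) $ i) 0"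
        if "n \<le> 2" for n i
        using same_2jet_of_same_frame[OF op f[of i] w.solutions[of i] T(1,2,5,3,4)
            frf[of i, unfolded p0] k_def[unfolded p0] that]
        by (simp only: \<gamma> \<rho>_def vec_lambda_beta vector_smult_component)
      moreover have "smooth1_on T (\<lambda>t. lift_of f (\<gamma> t) $ i)" "smooth1_on T (\<lambda>t. (\<rho> t *s lift_of w (\<gamma> t)) $ i)" for i
        using fs[of i] smooth1_on_mult[OF T(1) \<rho>s ws[of i]] by (simp_all add: \<gamma>)
      ultimately show ?thesis
        unfolding second_order_contact_def act using T(1,2,5)
        by (intro exI[of _ T] exI[of _ "\<lambda>t. t"] exI[of _ "\<lambda>t. lift_of f (\<gamma> t)"] exI[of _ "\<lambda>t. \<rho> t *s lift_of w (\<gamma> t)"]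
            conjI ballI allI impI smooth1_on_id) (simp_all add: \<gamma>)
    qed
    have "proj_act g (map_of_functions u p) = map_of_functions w p"
      unfolding act by (simp add: map_of_functions_def fp)
    with detg contact show ?thesis by blast
  qed
  then show ?thesis
    unfolding projective_deformation_def
    using smooth2_on_fst[OF op] smooth2_on_snd[OF op] by simp
qed

lemma partials_mult:
  assumes "smooth2_on U f" "smooth2_on U g" "p \<in> U"
  shows "pdx (\<lambda>q. f q * g q) p = pdx f p * g p + f p * pdx g p"
    and "pdy (\<lambda>q. f q * g q) p = pdy f p * g p + f p * pdy g p"
  using has_partials_on_pdx has_partials_on_pdy
    has_partials_on_mult[OF smooth2_onD(1)[OF assms(1)] smooth2_onD(1)[OF assms(2)]] assms(3)
  by blast+

lemma second_partials_mult:
  assumes "open U" "smooth2_on U f" "smooth2_on U g" "p \<in> U"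
  shows "pdx (pdx (\<lambda>q. f q * g q)) p = pdx (pdx f) p * g p + 2 * (pdx f p * pdx g p) + f p * pdx (pdx g) p"
    and "pdy (pdy (\<lambda>q. f q * g q)) p = pdy (pdy f) p * g p + 2 * (pdy f p * pdy g p) + f p * pdy (pdy g) p"
proof -
  note P = has_partials_on_add[OF has_partials_on_mult has_partials_on_mult, OF smooth2_onD(1) smooth2_onD(1) smooth2_onD(1) smooth2_onD(1)]
  note D = smooth2_onD(2,3)[OF assms(2)] smooth2_onD(2,3)[OF assms(3)]
  have "pdx (pdx (\<lambda>q. f q * g q)) p = pdx (\<lambda>q. pdx f q * g q + f q * pdx g q) p"
    using partials_mult[OF assms(2,3)] by (intro pdx_cong[OF assms(1,4)])
  also have "\<dots> = pdx (pdx f) p * g p + 2 * (pdx f p * pdx g p) + f p * pdx (pdx g) p"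
    using has_partials_on_pdx[OF P[OF D(1) assms(3) assms(2) D(3)] assms(4)] by (simp add: algebra_simps)
  finally show "pdx (pdx (\<lambda>q. f q * g q)) p = pdx (pdx f) p * g p + 2 * (pdx f p * pdx g p) + f p * pdx (pdx g) p" .
  have "pdy (pdy (\<lambda>q. f q * g q)) p = pdy (\<lambda>q. pdy f q * g q + f q * pdy g q) p"
    using partials_mult[OF assms(2,3)] by (intro pdy_cong[OF assms(1,4)])
  also have "\<dots> = pdy (pdy f) p * g p + 2 * (pdy f p * pdy g p) + f p * pdy (pdy g) p"
    using has_partials_on_pdy[OF P[OF D(2) assms(3) assms(2) D(4)] assms(4)] by (simp add: algebra_simps)
  finally show "pdy (pdy (\<lambda>q. f q * g q)) p = pdy (pdy f) p * g p + 2 * (pdy f p * pdy g p) + f p * pdy (pdy g) p" .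
qed

text \<open>
  If a trivial deformation relates the two surfaces, the lifts satisfy \<open>w = \<Lambda> g u\<close>. As the
  constant \<open>1\<close> is a solution of the first system, \<open>\<Lambda>\<close> is a solution of the second, and so is
  \<open>\<Lambda> f\<close> for every solution \<open>f\<close> of the first.  Comparing second derivatives of \<open>\<Lambda> f\<close> for solutions \<open>f\<close>
  with prescribed frames gives \<open>\<Lambda>\<^sub>x = \<Lambda>\<^sub>y = 0\<close>, and then the equations for \<open>\<Lambda>\<close> force \<open>\<mu> = \<nu> = 0\<close>.
\<close>

lemma trivial_deformation_potentials_vanish:
  fixes u w :: "4 \<Rightarrow> 'k \<times> 'k \<Rightarrow> 'k::{real_normed_field,euclidean_space}"
  assumes "fundamental_system b (\<lambda>_. 0) c (\<lambda>_. 0) U u" "fundamental_system b \<mu> c \<nu> U w"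
    and one: "\<And>p. p \<in> U \<Longrightarrow> lincomb a1 u p = 1"
    and triv: "trivial_deformation U (map_of_functions u) (map_of_functions w) (\<lambda>p. p)"
    and p: "p \<in> U"
  shows "\<mu> p = 0 \<and> \<nu> p = 0"
proof -
  interpret u: fundamental_system b "\<lambda>_. 0" c "\<lambda>_. 0" U u by fact
  interpret w: fundamental_system b \<mu> c \<nu> U w by fact
  note op = u.open_domain
  obtain g :: "'k ^ 4 ^ 4" where g: "invertible g"
    "\<And>p. p \<in> U \<Longrightarrow> map_of_functions w p = proj_act g (map_of_functions u p)"
    using triv by (auto simp: trivial_deformation_def)
  have "\<exists>l. l \<noteq> 0 \<and> lift_of w q = l *s (g *v lift_of u q)" if "q \<in> U" for q
  proof -
    have "lift_of w q \<in> pt (g *v lift_of u q)"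
      using mem_pt_self[of "lift_of w q"] g(2)[OF that] by (simp add: map_of_functions_def proj_act_pt)
    then show ?thesis by (auto simp: pt_def)
  qed
  then obtain \<Lambda> where \<Lambda>: "\<And>q. q \<in> U \<Longrightarrow> \<Lambda> q \<noteq> 0 \<and> lift_of w q = \<Lambda> q *s (g *v lift_of u q)" by metis
  obtain h where h: "g ** h = mat 1" "h ** g = mat 1" using g(1) by (auto simp: invertible_def)
  define d where "d a = transpose h *v a" for a
  have dw: "lincomb (d a) w q = \<Lambda> q * lincomb a u q" if "q \<in> U" for a q
  proof -
    have dot: "lincomb e v q = (\<Sum>i\<in>UNIV. e $ i * lift_of v q $ i)" for e v by (simp add: lincomb_def)
    have "(\<Sum>i\<in>UNIV. d a $ i * (g *v v) $ i) = (\<Sum>i\<in>UNIV. a $ i * v $ i)" for v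
    proof -
      have "(\<Sum>i\<in>UNIV. d a $ i * (g *v v) $ i) = (\<Sum>i\<in>UNIV. a $ i * (h *v (g *v v)) $ i)"
        unfolding d_def matrix_vector_mult_def[of "transpose h"] matrix_vector_mult_def[of h]
        by (simp add: sum_4 transpose_def algebra_simps)
      then show ?thesis by (simp add: matrix_vector_mul_assoc h)
    qed
    note this[of "lift_of u q"]
    moreover have "lincomb (d a) w q = \<Lambda> q * (\<Sum>i\<in>UNIV. d a $ i * (g *v lift_of u q) $ i)"
      unfolding dot using \<Lambda>[OF that] by (simp add: sum_distrib_left mult_ac)
    ultimately show ?thesis by (simp add: dot)
  qed
  define L where "L = lincomb (d a1) w"
  have L: "solves b \<mu> c \<nu> U L" unfolding L_def by (rule solves_lincomb[OF op w.solutions])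
  have L\<Lambda>: "L q = \<Lambda> q" if "q \<in> U" for q using dw[OF that, of a1] one[OF that] by (simp add: L_def)
  have Ls: "smooth2_on U L" using L by (simp add: solves_def)
  have prod: "solves b \<mu> c \<nu> U (\<lambda>q. L q * lincomb a u q)" for a
  proof -
    have "solves b \<mu> c \<nu> U (lincomb (d a) w)" by (rule solves_lincomb[OF op w.solutions])
    then show ?thesis by (rule w.solves_cong) (simp add: dw L\<Lambda>)
  qed
  have zero: "pdx L q = 0 \<and> pdy L q = 0" if q: "q \<in> U" for q
  proof -
    have sur: "\<exists>a. frame (lincomb a u) q = v" for v
    proof -
      have "surj ((*v) (wronskian u q))"
        using u.wronskian_nonzero[OF q] invertible_det_nz invertible_right_inverse
          matrix_right_invertible_surjective by blast
      then obtain a where "v = wronskian u q *v a" by (metis surjD)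
      then have "frame (lincomb a u) q = v" by (simp add: frame_lincomb[OF op u.smooth_solutions q])
      then show ?thesis ..
    qed
    obtain a where "frame (lincomb a u) q = vector [0, 1, 0, 0]" using sur by blast
    then have f: "lincomb a u q = 0" "pdx (lincomb a u) q = 1" "pdy (lincomb a u) q = 0"
      by (simp_all add: frame_def vec_eq_iff forall_4)
    obtain a' where "frame (lincomb a' u) q = vector [0, 0, 1, 0]" using sur by blast
    then have f': "lincomb a' u q = 0" "pdx (lincomb a' u) q = 0" "pdy (lincomb a' u) q = 1"
      by (simp_all add: frame_def vec_eq_iff forall_4)
    have us: "smooth2_on U (lincomb a u)" for a by (rule smooth2_on_lincomb[OF op u.smooth_solutions])
    have lu: "solves b (\<lambda>_. 0) c (\<lambda>_. 0) U (lincomb a u)" for a by (rule solves_lincomb[OF op u.solutions])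
    have "2 * pdx L q = 0"
    proof -
      have "pdx (pdx (\<lambda>q. L q * lincomb a u q)) q
          = b q * pdy (\<lambda>q. L q * lincomb a u q) q + \<mu> q * (L q * lincomb a u q)"
        "pdx (pdx (lincomb a u)) q = b q * pdy (lincomb a u) q"
        using prod[of a] lu[of a] q by (auto simp: solves_def)
      then show ?thesis
        unfolding second_partials_mult[OF op Ls us q] partials_mult[OF Ls us q] by (simp add: f)
    qed
    moreover have "2 * pdy L q = 0"
    proof -
      have "pdy (pdy (\<lambda>q. L q * lincomb a' u q)) q
          = c q * pdx (\<lambda>q. L q * lincomb a' u q) q + \<nu> q * (L q * lincomb a' u q)"
        "pdy (pdy (lincomb a' u)) q = c q * pdx (lincomb a' u) q"
        using prod[of a'] lu[of a'] q by (auto simp: solves_def)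
      then show ?thesis
        unfolding second_partials_mult[OF op Ls us q] partials_mult[OF Ls us q] by (simp add: f')
    qed
    ultimately show ?thesis by simp
  qed
  have "pdx (pdx L) p = 0" "pdy (pdy L) p = 0"
    using pdx_cong[OF op p, of "pdx L" "\<lambda>_. 0"] pdy_cong[OF op p, of "pdy L" "\<lambda>_. 0"] zero
    by (simp_all add: pdx_def pdy_def split_beta)
  then have "\<mu> p * L p = 0" "\<nu> p * L p = 0"
    using L p zero[OF p] by (auto simp: solves_def)
  then show ?thesis using L\<Lambda>[OF p] \<Lambda>[OF p] by simp
qed

section \<open>Explicit solutions of the family\<close>

lemma has_partials_on_eq:
  assumes "has_partials_on U f fx fy" "\<And>p. p \<in> U \<Longrightarrow> fx p = gx p" "\<And>p. p \<in> U \<Longrightarrow> fy p = gy p"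
  shows "has_partials_on U f gx gy"
  using assms by (simp add: has_partials_on_def)

lemma solves_by_partials:
  assumes "open U" "has_partials_on U z zx zy" "has_partials_on U zx zxx zxy" "has_partials_on U zy zyx zyy"
    "smooth2_on U zx" "smooth2_on U zy"
    "\<And>p. p \<in> U \<Longrightarrow> zxx p = b p * zy p + \<mu> p * z p" "\<And>p. p \<in> U \<Longrightarrow> zyy p = c p * zx p + \<nu> p * z p"
  shows "solves b \<mu> c \<nu> U z"
    and "\<And>p. p \<in> U \<Longrightarrow> frame z p = vector [z p, zx p, zy p, zxy p]"
proof -
  have d: "pdx z p = zx p" "pdy z p = zy p" if "p \<in> U" for p
    using has_partials_on_pdx[OF assms(2) that] has_partials_on_pdy[OF assms(2) that] by auto
  have "pdx (pdx z) p = zxx p" "pdy (pdx z) p = zxy p" "pdy (pdy z) p = zyy p" if "p \<in> U" for p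
    using pdx_cong[OF assms(1) that, of "pdx z" zx] pdy_cong[OF assms(1) that, of "pdx z" zx]
      pdy_cong[OF assms(1) that, of "pdy z" zy] d that
      has_partials_on_pdx[OF assms(3) that] has_partials_on_pdy[OF assms(3) that] has_partials_on_pdy[OF assms(4) that]
    by auto
  then show "solves b \<mu> c \<nu> U z" "\<And>p. p \<in> U \<Longrightarrow> frame z p = vector [z p, zx p, zy p, zxy p]"
    using d assms(7,8) smooth2_onI[OF assms(1,2,5,6)] by (simp_all add: solves_def frame_def)
qed

lemma det_wronskian_nonzeroI:
  fixes z :: "4 \<Rightarrow> 'k \<times> 'k \<Rightarrow> 'k::real_normed_field"
  assumes "\<And>v :: 'k ^ 4. (\<And>i. v $ 1 * frame (z i) p $ 1 + v $ 2 * frame (z i) p $ 2 + v $ 3 * frame (z i) p $ 3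
    + v $ 4 * frame (z i) p $ 4 = 0) \<Longrightarrow> v = 0"
  shows "det (wronskian z p) \<noteq> 0"
proof
  assume "det (wronskian z p) = 0"
  then obtain v where v: "v \<noteq> 0" "transpose (wronskian z p) *v v = 0"
    using singular_matrix_kernel[of "transpose (wronskian z p)"] by auto
  have "v = 0"
  proof (rule assms)
    fix i
    have "(transpose (wronskian z p) *v v) $ i = 0" using v(2) by simp
    then show "v $ 1 * frame (z i) p $ 1 + v $ 2 * frame (z i) p $ 2 + v $ 3 * frame (z i) p $ 3
        + v $ 4 * frame (z i) p $ 4 = 0"
      by (simp add: matrix_vector_mult_def sum_4 transpose_def wronskian_def mult.commute)
  qed
  with v(1) show False ..
qed

text \<open>\<open>A\<close> and \<open>B\<close> play the part of \<open>log X / 4\<close> and \<open>log Y / k\<^sub>1\<close>; stated in terms of derivatives this avoids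
  branches of the logarithm and covers \<open>k\<^sub>1 = 0\<close>.\<close>

locale family =
  fixes k1 k2 k3 :: "'k::{real_normed_field,euclidean_space}" and U :: "('k \<times> 'k) set" and A B :: "'k \<Rightarrow> 'k"
  assumes open_U: "open U" and convex_U: "convex U" and nonempty_U: "U \<noteq> {}"
    and domain: "U \<subseteq> coeff_domain k1 k2 k3"
    and primitive_A: "p \<in> U \<Longrightarrow> (A has_field_derivative inverse (4 * fst p + k3)) (at (fst p))"
    and primitive_B: "p \<in> U \<Longrightarrow> (B has_field_derivative inverse (k1 * snd p + k2)) (at (snd p))"
begin

definition X :: "'k \<times> 'k \<Rightarrow> 'k" where "X p = 4 * fst p + k3"
definition Y :: "'k \<times> 'k \<Rightarrow> 'k" where "Y p = k1 * snd p + k2"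
definition iX :: "'k \<times> 'k \<Rightarrow> 'k" where "iX p = inverse (X p)"
definition iY :: "'k \<times> 'k \<Rightarrow> 'k" where "iY p = inverse (Y p)"

lemma nonzero: "p \<in> U \<Longrightarrow> X p \<noteq> 0" "p \<in> U \<Longrightarrow> Y p \<noteq> 0"
  using domain by (auto simp: X_def Y_def coeff_domain_def)

lemma cancel: "p \<in> U \<Longrightarrow> X p * iX p = 1" "p \<in> U \<Longrightarrow> Y p * iY p = 1"
  "p \<in> U \<Longrightarrow> iX p \<noteq> 0" "p \<in> U \<Longrightarrow> iY p \<noteq> 0"
  using nonzero by (simp_all add: iX_def iY_def)

lemma coeffs: "coeff_b k1 k2 k3 p = 4 * k1 * Y p * (iX p * iX p)" "coeff_c k1 k2 k3 p = X p * (iY p * iY p)"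
  by (simp_all add: coeff_b_def coeff_c_def split_beta X_def Y_def iX_def iY_def divide_inverse power2_eq_square)

lemma coeff_cancel:
  assumes "p \<in> U"
  shows "coeff_b k1 k2 k3 p * iY p = 4 * k1 * (iX p * iX p)" "coeff_c k1 k2 k3 p * iX p = iY p * iY p"
proof -
  have "coeff_b k1 k2 k3 p * iY p = (Y p * iY p) * (4 * k1 * (iX p * iX p))"
    "coeff_c k1 k2 k3 p * iX p = (X p * iX p) * (iY p * iY p)"
    unfolding coeffs by (simp_all only: mult_ac)
  then show "coeff_b k1 k2 k3 p * iY p = 4 * k1 * (iX p * iX p)" "coeff_c k1 k2 k3 p * iX p = iY p * iY p"
    by (simp_all only: cancel(1,2)[OF assms] mult_1)
qed

lemma partials:
  "has_partials_on U X (\<lambda>_. 4) (\<lambda>_. 0)" "has_partials_on U Y (\<lambda>_. 0) (\<lambda>_. k1)"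
  "has_partials_on U iX (\<lambda>p. - 4 * (iX p * iX p)) (\<lambda>_. 0)"
  "has_partials_on U iY (\<lambda>_. 0) (\<lambda>p. - k1 * (iY p * iY p))"
  "has_partials_on U (\<lambda>p. A (fst p)) iX (\<lambda>_. 0)" "has_partials_on U (\<lambda>p. B (snd p)) (\<lambda>_. 0) iY"
proof -
  show X: "has_partials_on U X (\<lambda>_. 4) (\<lambda>_. 0)"
    unfolding X_def[abs_def]
    by (rule has_partials_on_eq[OF has_partials_on_add[OF has_partials_on_mult[OF
            has_partials_on_const has_partials_on_fst] has_partials_on_const]]) auto
  show Y: "has_partials_on U Y (\<lambda>_. 0) (\<lambda>_. k1)"
    unfolding Y_def[abs_def]
    by (rule has_partials_on_eq[OF has_partials_on_add[OF has_partials_on_mult[OF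
            has_partials_on_const has_partials_on_snd] has_partials_on_const]]) auto
  show "has_partials_on U iX (\<lambda>p. - 4 * (iX p * iX p)) (\<lambda>_. 0)"
    unfolding iX_def[abs_def] by (rule has_partials_on_eq[OF has_partials_on_inverse[OF X nonzero(1)]]) auto
  show "has_partials_on U iY (\<lambda>_. 0) (\<lambda>p. - k1 * (iY p * iY p))"
    unfolding iY_def[abs_def] by (rule has_partials_on_eq[OF has_partials_on_inverse[OF Y nonzero(2)]]) auto
  have "continuous_on U (\<lambda>p. A (fst p))"
  proof -
    have "continuous_on (fst ` U) A"
      by (auto intro!: continuous_at_imp_continuous_on intro: DERIV_isCont[OF primitive_A])
    then show ?thesis by (rule continuous_on_compose2[OF _ continuous_on_fst[OF continuous_on_id]]) simp
  qed
  then show "has_partials_on U (\<lambda>p. A (fst p)) iX (\<lambda>_. 0)"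
    unfolding has_partials_on_def iX_def X_def
    by (intro conjI allI impI) (simp_all add: primitive_A[of "(_, _)", simplified])
  have "continuous_on U (\<lambda>p. B (snd p))"
  proof -
    have "continuous_on (snd ` U) B"
      by (auto intro!: continuous_at_imp_continuous_on intro: DERIV_isCont[OF primitive_B])
    then show ?thesis by (rule continuous_on_compose2[OF _ continuous_on_snd[OF continuous_on_id]]) simp
  qed
  then show "has_partials_on U (\<lambda>p. B (snd p)) (\<lambda>_. 0) iY"
    unfolding has_partials_on_def iY_def Y_def
    by (intro conjI allI impI) (simp_all add: primitive_B[of "(_, _)", simplified])
qed

lemma smooth:
  "smooth2_on U X" "smooth2_on U Y" "smooth2_on U iX" "smooth2_on U iY"
  "smooth2_on U (\<lambda>p. A (fst p))" "smooth2_on U (\<lambda>p. B (snd p))"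
proof -
  show X: "smooth2_on U X" and Y: "smooth2_on U Y"
    by (rule smooth2_onI[OF open_U partials(1) smooth2_on_const[OF open_U] smooth2_on_const[OF open_U]]
        smooth2_onI[OF open_U partials(2) smooth2_on_const[OF open_U] smooth2_on_const[OF open_U]])+
  show iX: "smooth2_on U iX" and iY: "smooth2_on U iY"
    using smooth2_on_inverse[OF open_U X nonzero(1)] smooth2_on_inverse[OF open_U Y nonzero(2)]
    by (simp_all add: iX_def[abs_def] iY_def[abs_def])
  show "smooth2_on U (\<lambda>p. A (fst p))" "smooth2_on U (\<lambda>p. B (snd p))"
    by (rule smooth2_onI[OF open_U partials(5) iX smooth2_on_const[OF open_U]]
        smooth2_onI[OF open_U partials(6) smooth2_on_const[OF open_U] iY])+
qed

lemmas smooth_rules = smooth2_on_add[OF open_U] smooth2_on_mult[OF open_U] smooth2_on_const[OF open_U] smooth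

text \<open>For \<open>k = k\<^sub>1 \<noteq> 0\<close> this is, up to a constant factor, the product of powers \<open>X\<^bsup>P/4\<^esup> Y\<^bsup>r/k\<^esup>\<close>.\<close>

definition monomial :: "'k \<Rightarrow> 'k \<Rightarrow> 'k \<times> 'k \<Rightarrow> 'k" where
  "monomial P r p = exp (P * A (fst p) + r * B (snd p))"

text \<open>Differentiation multiplies a monomial by \<open>P/X\<close> or \<open>r/Y\<close>, so the system turns into two
  quadratic equations for the exponents.\<close>

lemma monomial_solves:
  assumes \<alpha>: "\<alpha> = P * P - 4 * P - 4 * k1 * r" and \<beta>: "\<beta> = r * r - k1 * r - P"
  shows "solves (coeff_b k1 k2 k3) (\<lambda>p. \<alpha> * (iX p * iX p)) (coeff_c k1 k2 k3) (\<lambda>p. \<beta> * (iY p * iY p)) U (monomial P r)"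
    and "p \<in> U \<Longrightarrow> frame (monomial P r) p = monomial P r p *s vector [1, P * iX p, r * iY p, P * r * (iX p * iY p)]"
proof -
  let ?E = "monomial P r"
  have E: "has_partials_on U ?E (\<lambda>p. P * (iX p * ?E p)) (\<lambda>p. r * (iY p * ?E p))"
    unfolding monomial_def[abs_def]
    by (rule has_partials_on_eq[OF has_partials_on_exp[OF has_partials_on_add[OF
            has_partials_on_mult[OF has_partials_on_const partials(5)]
            has_partials_on_mult[OF has_partials_on_const partials(6)]]]]) auto
  have Ex: "has_partials_on U (\<lambda>p. P * (iX p * ?E p)) (\<lambda>p. (P * P - 4 * P) * (iX p * iX p) * ?E p)
      (\<lambda>p. P * r * (iX p * iY p) * ?E p)"
    by (rule has_partials_on_eq[OF has_partials_on_mult[OF has_partials_on_const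
            has_partials_on_mult[OF partials(3) E]]]) (auto simp: algebra_simps)
  have Ey: "has_partials_on U (\<lambda>p. r * (iY p * ?E p)) (\<lambda>p. P * r * (iX p * iY p) * ?E p)
      (\<lambda>p. (r * r - k1 * r) * (iY p * iY p) * ?E p)"
    by (rule has_partials_on_eq[OF has_partials_on_mult[OF has_partials_on_const
            has_partials_on_mult[OF partials(4) E]]]) (auto simp: algebra_simps)
  have Es: "smooth2_on U ?E"
    unfolding monomial_def[abs_def] by (intro smooth2_on_exp[OF open_U] smooth_rules)
  have eq: "(P * P - 4 * P) * (iX q * iX q) * ?E q
      = coeff_b k1 k2 k3 q * (r * (iY q * ?E q)) + \<alpha> * (iX q * iX q) * ?E q"
    "(r * r - k1 * r) * (iY q * iY q) * ?E q
      = coeff_c k1 k2 k3 q * (P * (iX q * ?E q)) + \<beta> * (iY q * iY q) * ?E q" if "q \<in> U" for q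
  proof -
    have e: "coeff_b k1 k2 k3 q * (r * (iY q * ?E q)) = (coeff_b k1 k2 k3 q * iY q) * (r * ?E q)"
      "coeff_c k1 k2 k3 q * (P * (iX q * ?E q)) = (coeff_c k1 k2 k3 q * iX q) * (P * ?E q)"
      by (simp_all only: mult_ac)
    show "(P * P - 4 * P) * (iX q * iX q) * ?E q
        = coeff_b k1 k2 k3 q * (r * (iY q * ?E q)) + \<alpha> * (iX q * iX q) * ?E q"
      "(r * r - k1 * r) * (iY q * iY q) * ?E q
        = coeff_c k1 k2 k3 q * (P * (iX q * ?E q)) + \<beta> * (iY q * iY q) * ?E q"
      unfolding e coeff_cancel[OF that] \<alpha> \<beta> by (simp_all add: algebra_simps)
  qed
  note S = solves_by_partials[OF open_U E Ex Ey smooth_rules(2)[OF smooth_rules(3) smooth_rules(2)[OF smooth(3) Es]]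
      smooth_rules(2)[OF smooth_rules(3) smooth_rules(2)[OF smooth(4) Es]] eq]
  show "solves (coeff_b k1 k2 k3) (\<lambda>p. \<alpha> * (iX p * iX p)) (coeff_c k1 k2 k3) (\<lambda>p. \<beta> * (iY p * iY p)) U ?E"
    by (rule S(1))
  show "frame ?E p = ?E p *s vector [1, P * iX p, r * iY p, P * r * (iX p * iY p)]" if "p \<in> U"
    using that by (simp add: S(2) vec_eq_iff forall_4)
qed

lemma monomial_nonzero: "monomial P r p \<noteq> 0"
  by (simp add: monomial_def)

text \<open>For \<open>\<alpha> = \<beta> = 0\<close> the exponent \<open>(0, 0)\<close> is a double root of the equations for \<open>(P, r)\<close>; this
  solution is the derivative of the monomials along the common tangent \<open>P + k\<^sub>1 r = 0\<close>.\<close>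

definition log_solution :: "'k \<times> 'k \<Rightarrow> 'k" where
  "log_solution p = k1 * A (fst p) + (- 1) * B (snd p)"

lemma partials_log_solution: "has_partials_on U log_solution (\<lambda>p. k1 * iX p) (\<lambda>p. (- 1) * iY p)"
  unfolding log_solution_def[abs_def]
  by (rule has_partials_on_eq[OF has_partials_on_add[OF has_partials_on_mult[OF has_partials_on_const partials(5)]
          has_partials_on_mult[OF has_partials_on_const partials(6)]]]) auto

lemma log_solution_solves:
  "solves (coeff_b k1 k2 k3) (\<lambda>_. 0) (coeff_c k1 k2 k3) (\<lambda>_. 0) U log_solution"
  "p \<in> U \<Longrightarrow> frame log_solution p = vector [log_solution p, k1 * iX p, - iY p, 0]"
proof -
  have x: "has_partials_on U (\<lambda>p. k1 * iX p) (\<lambda>p. - 4 * k1 * (iX p * iX p)) (\<lambda>_. 0)"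
    by (rule has_partials_on_eq[OF has_partials_on_mult[OF has_partials_on_const partials(3)]]) auto
  have y: "has_partials_on U (\<lambda>p. (- 1) * iY p) (\<lambda>_. 0) (\<lambda>p. k1 * (iY p * iY p))"
    by (rule has_partials_on_eq[OF has_partials_on_mult[OF has_partials_on_const partials(4)]]) auto
  have eq: "- 4 * k1 * (iX q * iX q) = coeff_b k1 k2 k3 q * ((- 1) * iY q) + 0 * log_solution q"
    "k1 * (iY q * iY q) = coeff_c k1 k2 k3 q * (k1 * iX q) + 0 * log_solution q" if "q \<in> U" for q
  proof -
    have e: "coeff_b k1 k2 k3 q * ((- 1) * iY q) = (coeff_b k1 k2 k3 q * iY q) * (- 1)"
      "coeff_c k1 k2 k3 q * (k1 * iX q) = (coeff_c k1 k2 k3 q * iX q) * k1"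
      by (simp_all only: mult_ac)
    show "- 4 * k1 * (iX q * iX q) = coeff_b k1 k2 k3 q * ((- 1) * iY q) + 0 * log_solution q"
      "k1 * (iY q * iY q) = coeff_c k1 k2 k3 q * (k1 * iX q) + 0 * log_solution q"
      unfolding e coeff_cancel[OF that] by (simp_all add: algebra_simps)
  qed
  have sx: "smooth2_on U (\<lambda>p. k1 * iX p)" and sy: "smooth2_on U (\<lambda>p. (- 1) * iY p)"
    by (intro smooth_rules)+
  note S = solves_by_partials[OF open_U partials_log_solution x y sx sy eq]
  show "solves (coeff_b k1 k2 k3) (\<lambda>_. 0) (coeff_c k1 k2 k3) (\<lambda>_. 0) U log_solution"
    by (rule S(1))
  show "frame log_solution p = vector [log_solution p, k1 * iX p, - iY p, 0]" if "p \<in> U"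
    using that by (simp add: S(2))
qed

text \<open>For \<open>k\<^sub>1 = \<plusminus>2\<close> the exponent \<open>(0, 0)\<close> becomes a triple root: one of the two remaining monomial
  solutions is constant.  This quadratic polynomial in the logarithms takes its place.\<close>

definition log2_solution :: "'k \<times> 'k \<Rightarrow> 'k" where
  "log2_solution p = log_solution p * log_solution p + 2 * A (fst p)"

lemma log2_solution_solves:
  assumes k1: "k1 * k1 = 4"
  shows "solves (coeff_b k1 k2 k3) (\<lambda>_. 0) (coeff_c k1 k2 k3) (\<lambda>_. 0) U log2_solution"
    and "p \<in> U \<Longrightarrow> frame log2_solution p = vector [log2_solution p,
      2 * (iX p * (k1 * log_solution p + 1)), - 2 * (iY p * log_solution p), - 2 * k1 * (iX p * iY p)]"
proof -
  let ?f = log_solution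
  have h: "has_partials_on U log2_solution (\<lambda>p. 2 * (iX p * (k1 * ?f p + 1))) (\<lambda>p. - 2 * (iY p * ?f p))"
    unfolding log2_solution_def[abs_def]
    by (rule has_partials_on_eq[OF has_partials_on_add[OF has_partials_on_mult[OF partials_log_solution partials_log_solution]
            has_partials_on_mult[OF has_partials_on_const partials(5)]]]) (auto simp: algebra_simps)
  have x: "has_partials_on U (\<lambda>p. 2 * (iX p * (k1 * ?f p + 1)))
      (\<lambda>p. (2 * (k1 * k1) - 8 - 8 * k1 * ?f p) * (iX p * iX p)) (\<lambda>p. - 2 * k1 * (iX p * iY p))"
    by (rule has_partials_on_eq[OF has_partials_on_mult[OF has_partials_on_const has_partials_on_mult[OF partials(3)
            has_partials_on_add[OF has_partials_on_mult[OF has_partials_on_const partials_log_solution] has_partials_on_const]]]])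
      (auto simp: algebra_simps)
  have y: "has_partials_on U (\<lambda>p. - 2 * (iY p * ?f p)) (\<lambda>p. - 2 * k1 * (iX p * iY p))
      (\<lambda>p. (2 + 2 * k1 * ?f p) * (iY p * iY p))"
    by (rule has_partials_on_eq[OF has_partials_on_mult[OF has_partials_on_const has_partials_on_mult[OF partials(4)
            partials_log_solution]]]) (auto simp: algebra_simps)
  have fs: "smooth2_on U ?f" using log_solution_solves(1) by (simp add: solves_def)
  have sx: "smooth2_on U (\<lambda>p. 2 * (iX p * (k1 * ?f p + 1)))" and sy: "smooth2_on U (\<lambda>p. - 2 * (iY p * ?f p))"
    by (intro smooth_rules fs)+
  have eq: "(2 * (k1 * k1) - 8 - 8 * k1 * ?f q) * (iX q * iX q)
      = coeff_b k1 k2 k3 q * (- 2 * (iY q * ?f q)) + 0 * log2_solution q"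
    "(2 + 2 * k1 * ?f q) * (iY q * iY q)
      = coeff_c k1 k2 k3 q * (2 * (iX q * (k1 * ?f q + 1))) + 0 * log2_solution q" if "q \<in> U" for q
  proof -
    have e: "coeff_b k1 k2 k3 q * (- 2 * (iY q * ?f q)) = (coeff_b k1 k2 k3 q * iY q) * (- 2 * ?f q)"
      "coeff_c k1 k2 k3 q * (2 * (iX q * (k1 * ?f q + 1))) = (coeff_c k1 k2 k3 q * iX q) * (2 * (k1 * ?f q + 1))"
      by (simp_all only: mult_ac)
    show "(2 * (k1 * k1) - 8 - 8 * k1 * ?f q) * (iX q * iX q)
        = coeff_b k1 k2 k3 q * (- 2 * (iY q * ?f q)) + 0 * log2_solution q"
      "(2 + 2 * k1 * ?f q) * (iY q * iY q)
        = coeff_c k1 k2 k3 q * (2 * (iX q * (k1 * ?f q + 1))) + 0 * log2_solution q"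
      unfolding e coeff_cancel[OF that] k1 by (simp_all add: algebra_simps)
  qed
  note S = solves_by_partials[OF open_U h x y sx sy eq]
  show "solves (coeff_b k1 k2 k3) (\<lambda>_. 0) (coeff_c k1 k2 k3) (\<lambda>_. 0) U log2_solution"
    by (rule S(1))
  show "frame log2_solution p = vector [log2_solution p,
      2 * (iX p * (k1 * log_solution p + 1)), - 2 * (iY p * log_solution p), - 2 * k1 * (iX p * iY p)]" if "p \<in> U"
    using that by (simp add: S(2))
qed

lemma system: "linear_system (coeff_b k1 k2 k3) (\<lambda>p. \<alpha> * (iX p * iX p)) (coeff_c k1 k2 k3) (\<lambda>p. \<beta> * (iY p * iY p)) U"
  unfolding linear_system_def coeffs[abs_def] fun_eq_iff
  by (intro conjI open_U convex_U) (intro smooth_rules)+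

end

section \<open>The family is projectively applicable\<close>

lemma cubic_four_roots_zero:
  fixes a0 a1 a2 a3 :: "'k::idom" and r :: "4 \<Rightarrow> 'k"
  assumes "inj r" and "\<And>i. a0 + a1 * r i + a2 * (r i * r i) + a3 * (r i * r i * r i) = 0"
  shows "a0 = 0 \<and> a1 = 0 \<and> a2 = 0 \<and> a3 = 0"
proof (rule ccontr)
  let ?q = "[:a0, a1, a2, a3:]"
  assume "\<not> ?thesis"
  then have nz: "?q \<noteq> 0" by auto
  have "range r \<subseteq> {x. poly ?q x = 0}" using assms(2) by (auto simp: algebra_simps)
  then have "card (range r) \<le> card {x. poly ?q x = 0}"
    by (rule card_mono[OF poly_roots_finite[OF nz]])
  also have "\<dots> \<le> degree ?q" by (rule card_poly_roots_bound[OF nz])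
  also have "\<dots> \<le> 3" by simp
  finally show False using assms(1) by (simp add: card_image)
qed

text \<open>Frames at a point are related by a matrix of determinant 1 only if the Wronskians agree; as these are
  constant, a constant factor at one of the solutions achieves this.  It also corrects the sign over the reals,
  where a common factor of all four solutions would enter with its fourth power.\<close>

lemma fundamental_system_rescale:
  assumes "fundamental_system b \<mu> c \<nu> U w" "s \<noteq> 0"
  obtains w' where "fundamental_system b \<mu> c \<nu> U w'"
    "\<And>p. p \<in> U \<Longrightarrow> det (wronskian w' p) = s * det (wronskian w p)"
proof
  interpret w: fundamental_system b \<mu> c \<nu> U w by fact
  define R :: "'a ^ 4 ^ 4" where "R = (\<chi> i j. if i = j then if i = 1 then s else 1 else 0)"
  let ?w = "\<lambda>i. lincomb (column i R) w"
  have "det R = (\<Prod>i\<in>UNIV. R $ i $ i)" by (rule det_diagonal) (simp add: R_def)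
  also have "\<dots> = s" unfolding UNIV_4 by (simp add: R_def)
  finally show det: "det (wronskian ?w p) = s * det (wronskian w p)" if "p \<in> U" for p
    by (simp add: wronskian_lincomb[OF w.open_domain w.smooth_solutions that] det_mul)
  have "solves b \<mu> c \<nu> U (?w i)" for i by (rule solves_lincomb[OF w.open_domain w.solutions])
  then show "fundamental_system b \<mu> c \<nu> U ?w"
    using w.linear_system_axioms det w.wronskian_nonzero assms(2)
    by (simp add: fundamental_system_def fundamental_system_axioms_def)
qed

context family
begin

abbreviation "bf \<equiv> coeff_b k1 k2 k3"
abbreviation "cf \<equiv> coeff_c k1 k2 k3"

lemma monomial_solves_family:
  "P * P = 4 * P + 4 * k1 * r \<Longrightarrow> r * r = k1 * r + P \<Longrightarrow>
    solves bf (\<lambda>_. 0) cf (\<lambda>_. 0) U (monomial P r)"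
  using monomial_solves(1)[OF refl refl, of P r] by simp

text \<open>In a linear relation between the rows of the Wronskian matrix, the solution \<open>1\<close> removes the first
  coefficient and the solution \<open>k\<^sub>1A - B\<close> gives \<open>n = k\<^sub>1 m\<close>; the two other solutions decide.  Here \<open>m, n, l\<close> are
  the coefficients divided by \<open>X\<close>, \<open>Y\<close> and \<open>X Y\<close>.\<close>

lemma family_frames_independent:
  fixes e :: "4 \<Rightarrow> 'k \<times> 'k \<Rightarrow> 'k"
  assumes p: "p \<in> U" and e1: "e 1 = monomial 0 0" and e2: "e 2 = log_solution"
    and e34: "\<And>m n l. k1 * m = n \<Longrightarrow>
      (\<And>i. i = 3 \<or> i = 4 \<Longrightarrow> m * (X p * frame (e i) p $ 2) + n * (Y p * frame (e i) p $ 3)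
        + l * (X p * Y p * frame (e i) p $ 4) = 0) \<Longrightarrow> m = 0 \<and> l = 0"
  shows "det (wronskian e p) \<noteq> 0"
proof (rule det_wronskian_nonzeroI)
  fix v :: "'k ^ 4"
  assume v: "v $ 1 * frame (e i) p $ 1 + v $ 2 * frame (e i) p $ 2 + v $ 3 * frame (e i) p $ 3
    + v $ 4 * frame (e i) p $ 4 = 0" for i
  have v1: "v $ 1 = 0"
    using v[of 1] monomial_solves(2)[OF refl refl p, of 0 0] monomial_nonzero[of 0 0 p] by (simp add: e1)
  define m n l where "m = v $ 2 * iX p" and "n = v $ 3 * iY p" and "l = v $ 4 * (iX p * iY p)"
  have vm: "v $ 2 = m * X p" "v $ 3 = n * Y p" "v $ 4 = l * (X p * Y p)"
    using nonzero[OF p] by (simp_all add: m_def n_def l_def iX_def iY_def field_simps)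
  have "k1 * m = n"
    using v[of 2] log_solution_solves(2)[OF p] v1 by (simp add: e2 m_def n_def algebra_simps)
  moreover have "m * (X p * frame (e i) p $ 2) + n * (Y p * frame (e i) p $ 3)
        + l * (X p * Y p * frame (e i) p $ 4) = 0" for i
    using v[of i] v1 by (simp add: vm algebra_simps)
  ultimately have "m = 0" "l = 0" "n = 0" using e34[of m n l] by auto
  then show "v = 0" using v1 vm by (simp add: vec_eq_iff forall_4)
qed

lemma scaled_frame_monomial:
  assumes "p \<in> U"
  shows "m * (X p * frame (monomial P r) p $ 2) + n * (Y p * frame (monomial P r) p $ 3)
      + l * (X p * Y p * frame (monomial P r) p $ 4) = monomial P r p * (m * P + n * r + l * (P * r))"
proof -
  have "m * (X p * frame (monomial P r) p $ 2) + n * (Y p * frame (monomial P r) p $ 3)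
      + l * (X p * Y p * frame (monomial P r) p $ 4)
    = monomial P r p * (m * P * (X p * iX p) + n * r * (Y p * iY p) + l * (P * r) * ((X p * iX p) * (Y p * iY p)))"
    unfolding monomial_solves(2)[OF refl refl assms] by (simp add: algebra_simps)
  then show ?thesis by (simp add: cancel[OF assms])
qed

lemma family_fundamental_system:
  obtains e where "fundamental_system bf (\<lambda>_. 0) cf (\<lambda>_. 0) U e"
proof -
  have sys: "linear_system bf (\<lambda>_. 0) cf (\<lambda>_. 0) U" using system[of 0 0] by simp
  have one: "solves bf (\<lambda>_. 0) cf (\<lambda>_. 0) U (monomial 0 0)"
    by (rule monomial_solves_family) auto
  show thesis
  proof (cases "k1 * k1 = 4")
    case False
    define e where "e i = (if i = 1 then monomial 0 0 else if i = 2 then log_solution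
      else if i = 3 then monomial (4 + 2 * k1) (k1 + 2) else monomial (4 - 2 * k1) (k1 - 2))" for i :: 4
    have "solves bf (\<lambda>_. 0) cf (\<lambda>_. 0) U (e i)" for i
      using one log_solution_solves(1) by (auto simp: e_def algebra_simps intro!: monomial_solves_family)
    moreover have "det (wronskian e p) \<noteq> 0" if p: "p \<in> U" for p
    proof (rule family_frames_independent[OF p])
      fix m n l assume n: "k1 * m = n"
        and h: "\<And>i. i = 3 \<or> i = 4 \<Longrightarrow> m * (X p * frame (e i) p $ 2) + n * (Y p * frame (e i) p $ 3)
          + l * (X p * Y p * frame (e i) p $ 4) = 0"
      have "m * (4 + 2 * k1) + n * (k1 + 2) + l * ((4 + 2 * k1) * (k1 + 2)) = 0"
        "m * (4 - 2 * k1) + n * (k1 - 2) + l * ((4 - 2 * k1) * (k1 - 2)) = 0"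
        using h[of 3] h[of 4] unfolding e_def
        by (simp_all add: scaled_frame_monomial[OF p] monomial_nonzero del: distrib_left_numeral right_diff_distrib_numeral)
      then have "(k1 + 2) * (k1 + 2) * (m + 2 * l) = 0" "(k1 - 2) * (k1 - 2) * (m - 2 * l) = 0"
        unfolding n[symmetric] by (simp_all only: algebra_simps) (simp_all del: mult_eq_0_iff add: algebra_simps)
      moreover have "k1 + 2 \<noteq> 0" "k1 - 2 \<noteq> 0"
      proof -
        have "(k1 + 2) * (k1 - 2) = k1 * k1 - 4" by (simp add: algebra_simps)
        then show "k1 + 2 \<noteq> 0" "k1 - 2 \<noteq> 0" using False by auto
      qed
      ultimately have "m + 2 * l = 0" "m - 2 * l = 0" by auto
      moreover from this have "2 * m = 0" "4 * l = 0" by (simp_all add: algebra_simps)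
      ultimately show "m = 0 \<and> l = 0" by simp
    qed (simp_all add: e_def)
    ultimately show thesis
      using that[of e] sys by (simp add: fundamental_system_def fundamental_system_axioms_def)
  next
    case True
    define e where "e i = (if i = 1 then monomial 0 0 else if i = 2 then log_solution
      else if i = 3 then log2_solution else monomial 8 (2 * k1))" for i :: 4
    have "solves bf (\<lambda>_. 0) cf (\<lambda>_. 0) U (monomial 8 (2 * k1))"
      using True by (intro monomial_solves_family) (simp_all add: algebra_simps)
    then have "solves bf (\<lambda>_. 0) cf (\<lambda>_. 0) U (e i)" for i
      using one log_solution_solves(1) log2_solution_solves(1)[OF True] by (simp add: e_def)
    moreover have "det (wronskian e p) \<noteq> 0" if p: "p \<in> U" for p
    proof (rule family_frames_independent[OF p])
      fix m n l assume n: "k1 * m = n"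
        and h: "\<And>i. i = 3 \<or> i = 4 \<Longrightarrow> m * (X p * frame (e i) p $ 2) + n * (Y p * frame (e i) p $ 3)
          + l * (X p * Y p * frame (e i) p $ 4) = 0"
      have k: "k1 \<noteq> 0" using True by auto
      have "X p * frame log2_solution p $ 2 = (X p * iX p) * (2 * (k1 * log_solution p + 1))"
        "Y p * frame log2_solution p $ 3 = (Y p * iY p) * (- 2 * log_solution p)"
        "X p * Y p * frame log2_solution p $ 4 = (X p * iX p) * (Y p * iY p) * (- 2 * k1)"
        unfolding log2_solution_solves(2)[OF True p] vector_4 by (simp_all only: mult_ac)
      then have "X p * frame log2_solution p $ 2 = 2 * (k1 * log_solution p + 1)"
        "Y p * frame log2_solution p $ 3 = - 2 * log_solution p"
        "X p * Y p * frame log2_solution p $ 4 = - 2 * k1"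
        by (simp_all only: cancel[OF p] mult_1)
      then have a: "2 * (m - k1 * l) = 0"
        using h[of 3] unfolding e_def n[symmetric] by (simp add: algebra_simps)
      have "m * 8 + n * (2 * k1) + l * (8 * (2 * k1)) = 0"
        using h[of 4] unfolding e_def by (simp add: scaled_frame_monomial[OF p] monomial_nonzero)
      then have "8 * m + 2 * (k1 * k1) * m + 16 * k1 * l = 0"
        unfolding n[symmetric] by (simp del: mult_eq_0_iff add: mult_ac)
      then have "16 * (m + k1 * l) = 0" unfolding True by (simp del: mult_eq_0_iff add: algebra_simps)
      with a have "m + k1 * l = 0" "m - k1 * l = 0" by simp_all
      moreover from this have "2 * m = 0" "2 * (k1 * l) = 0" by (simp_all add: algebra_simps)
      ultimately show "m = 0 \<and> l = 0" using k by simp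
    qed (simp_all add: e_def)
    ultimately show thesis
      using that[of e] sys by (simp add: fundamental_system_def fundamental_system_axioms_def)
  qed
qed

text \<open>
  The exponents of the monomial solutions of the system with potentials \<open>\<alpha> / X\<^sup>2\<close> and \<open>\<beta> / Y\<^sup>2\<close> are
  the common zeros of two parabolas.  Eliminating \<open>P\<close> and shifting \<open>r = k\<^sub>1/2 + v\<close> leaves a quartic
  \<open>v\<^sup>4 + \<dots> - 4 k\<^sub>1 v + \<dots>\<close> without cubic term, of which the two omitted coefficients are free.  Its roots
  are therefore four numbers with sum zero whose three pairwise sums \<open>f, g, h\<close> (up to sign) have
  product \<open>- 4 k\<^sub>1\<close>.  For \<open>f = n\<close>, \<open>g = 2 n\<close> with \<open>n = 2 + |k\<^sub>1|\<close> the third one is so small that the roots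
  are distinct and that \<open>\<beta> \<noteq> 0\<close>.
\<close>

lemma deformed_exponents:
  obtains \<alpha> \<beta> :: 'k and P r :: "4 \<Rightarrow> 'k" where "inj r" "\<beta> \<noteq> 0"
    "\<And>i. \<alpha> = P i * P i - 4 * P i - 4 * k1 * r i" "\<And>i. \<beta> = r i * r i - k1 * r i - P i"
proof -
  define \<kappa> where "\<kappa> = norm k1"
  define f :: 'k where "f = of_real (2 + \<kappa>)"
  define g where "g = 2 * f"
  define h where "h = - 2 * k1 / (f * f)"
  have \<kappa>: "\<kappa> \<ge> 0" by (simp add: \<kappa>_def)
  have nf: "norm f = 2 + \<kappa>" unfolding f_def norm_of_real using \<kappa> by simp
  have f0: "f \<noteq> 0" using nf \<kappa> by auto
  have ng: "norm g = 2 * (2 + \<kappa>)" by (simp add: g_def norm_mult nf)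
  have "norm h = 2 * \<kappa> / ((2 + \<kappa>) * (2 + \<kappa>))" by (simp add: h_def norm_divide norm_mult nf \<kappa>_def)
  also have "\<dots> \<le> 1"
  proof (subst divide_le_eq_1_pos)
    show "0 < (2 + \<kappa>) * (2 + \<kappa>)" using \<kappa> by (intro mult_pos_pos) auto
    have "0 \<le> \<kappa> * \<kappa>" using \<kappa> by simp
    then show "2 * \<kappa> \<le> (2 + \<kappa>) * (2 + \<kappa>)" using \<kappa> by (simp add: algebra_simps)
  qed
  finally have nh: "norm h \<le> 1" .
  have fgh: "f * g * h = - 4 * k1" using f0 by (simp add: g_def h_def)
  define v where "v i = (if i = 1 then (g + h - f) / 2 else if i = 2 then (f + h - g) / 2
    else if i = 3 then (f + g - h) / 2 else - (f + g + h) / 2)" for i :: 4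
  define c where "c = (f * f + g * g + h * h) / 4"
  define r where "r i = k1 / 2 + v i" for i
  define P where "P i = 2 + (v i * v i - c)" for i
  have quartic: "(v i * v i - c) * (v i * v i - c) - 4 * k1 * v i
      = (f * f * g * g + g * g * h * h + f * f * h * h) / 4" for i
  proof -
    have "16 * ((v i * v i - c) * (v i * v i - c) + f * g * h * v i)
        = 16 * ((f * f * g * g + g * g * h * h + f * f * h * h) / 4)"
      unfolding v_def c_def by (simp add: field_simps)
    then have "(v i * v i - c) * (v i * v i - c) + f * g * h * v i
        = (f * f * g * g + g * g * h * h + f * f * h * h) / 4"
      by (simp only: mult_cancel_left) simp
    then show ?thesis unfolding fgh by simp
  qed
  have "inj v"
  proof -
    have diff: "norm (x + y) \<noteq> 0" if "norm y < norm x" for x y :: 'k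
      using that norm_minus_cancel[of y] by (auto simp: add_eq_0_iff)
    have "g + h \<noteq> 0" "f + h \<noteq> 0" "f + (- h) \<noteq> 0" "g + (- h) \<noteq> 0"
      using diff[of h g] diff[of h f] diff[of "- h" f] diff[of "- h" g] nf ng nh \<kappa> by auto
    moreover have "f + g = 3 * f" "g - f = f" by (simp_all add: g_def)
    moreover have "v 1 - v 2 = g - f" "v 1 - v 3 = - (f + (- h))" "v 1 - v 4 = g + h"
      "v 2 - v 3 = - (g + (- h))" "v 2 - v 4 = f + h" "v 3 - v 4 = f + g"
      by (simp_all add: v_def field_simps)
    ultimately have ne: "v 1 - v 2 \<noteq> 0" "v 1 - v 3 \<noteq> 0" "v 1 - v 4 \<noteq> 0" "v 2 - v 3 \<noteq> 0" "v 2 - v 4 \<noteq> 0" "v 3 - v 4 \<noteq> 0"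
      using f0 by (simp_all only: neg_equal_0_iff_equal mult_eq_0_iff) simp_all
    have "\<forall>i j. v i = v j \<longrightarrow> i = j"
      unfolding forall_4 using ne by auto
    then show ?thesis by (simp add: inj_def)
  qed
  then have "inj r" by (simp add: inj_def r_def)
  moreover have "c - 2 - k1 * k1 / 4 \<noteq> 0"
  proof
    assume "c - 2 - k1 * k1 / 4 = 0"
    then have "4 * (5 * (f * f)) = 4 * (8 + k1 * k1 - h * h)"
      by (simp add: c_def g_def field_simps)
    then have "5 * (f * f) = 8 + k1 * k1 - h * h"
      by (simp only: mult_cancel_left) simp
    then have "norm (5 * (f * f)) \<le> norm (8 + k1 * k1) + norm (h * h)"
      by (simp only: norm_triangle_ineq4)
    also have "\<dots> \<le> norm (8 :: 'k) + norm (k1 * k1) + norm (h * h)"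
      by (intro add_right_mono norm_triangle_ineq)
    finally have "norm (5 * (f * f)) \<le> norm (8 :: 'k) + norm (k1 * k1) + norm (h * h)" .
    then have "5 * ((2 + \<kappa>) * (2 + \<kappa>)) \<le> 8 + \<kappa> * \<kappa> + norm h * norm h"
      by (simp add: norm_mult nf \<kappa>_def)
    moreover have "norm h * norm h \<le> 1" using nh by (simp add: mult_le_one)
    moreover have "0 \<le> \<kappa> * \<kappa>" using \<kappa> by simp
    ultimately show False using \<kappa> by (simp add: algebra_simps)
  qed
  moreover have "c - 2 - k1 * k1 / 4 = r i * r i - k1 * r i - P i" for i
    by (simp add: r_def P_def field_simps)
  moreover have "(f * f * g * g + g * g * h * h + f * f * h * h) / 4 - 4 - 2 * k1 * k1
      = P i * P i - 4 * P i - 4 * k1 * r i" for i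
    unfolding quartic[of i, symmetric] by (simp add: r_def P_def algebra_simps)
  ultimately show thesis using that by blast
qed

text \<open>As \<open>P\<^sub>i = r\<^sub>i\<^sup>2 - k\<^sub>1r\<^sub>i - \<beta>\<close>, a linear relation between \<open>1, P\<^sub>i, r\<^sub>i, P\<^sub>ir\<^sub>i\<close> is a cubic polynomial with the
  four zeros \<open>r\<^sub>i\<close>.\<close>

lemma deformed_fundamental_system:
  obtains \<alpha> \<beta> w where "\<beta> \<noteq> 0"
    "fundamental_system bf (\<lambda>p. \<alpha> * (iX p * iX p)) cf (\<lambda>p. \<beta> * (iY p * iY p)) U w"
proof -
  obtain \<alpha> \<beta> :: 'k and P r :: "4 \<Rightarrow> 'k" where inj: "inj r" and \<beta>0: "\<beta> \<noteq> 0"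
    and \<alpha>: "\<And>i. \<alpha> = P i * P i - 4 * P i - 4 * k1 * r i"
    and \<beta>: "\<And>i. \<beta> = r i * r i - k1 * r i - P i"
    by (rule deformed_exponents) (rule that)
  let ?w = "\<lambda>i. monomial (P i) (r i)"
  have P: "P i = r i * r i - k1 * r i - \<beta>" for i using \<beta>[of i] by (simp add: algebra_simps)
  have "det (wronskian ?w p) \<noteq> 0" if p: "p \<in> U" for p
  proof (rule det_wronskian_nonzeroI)
    fix v :: "'k ^ 4"
    assume v: "v $ 1 * frame (?w i) p $ 1 + v $ 2 * frame (?w i) p $ 2 + v $ 3 * frame (?w i) p $ 3
      + v $ 4 * frame (?w i) p $ 4 = 0" for i
    define m n l where "m = v $ 2 * iX p" and "n = v $ 3 * iY p" and "l = v $ 4 * (iX p * iY p)"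
    have "v $ 1 + m * P i + n * r i + l * (P i * r i) = 0" for i
    proof -
      have "monomial (P i) (r i) p * (v $ 1 + m * P i + n * r i + l * (P i * r i)) = 0"
        using v[of i] unfolding monomial_solves(2)[OF refl refl p] m_def n_def l_def
        by (simp del: mult_eq_0_iff add: algebra_simps)
      then show ?thesis by (simp add: monomial_nonzero)
    qed
    then have "(v $ 1 - \<beta> * m) + (n - k1 * m - \<beta> * l) * r i + (m - k1 * l) * (r i * r i) + l * (r i * r i * r i) = 0" for i
      by (simp add: P algebra_simps)
    from cubic_four_roots_zero[OF inj this] have "v $ 1 = 0 \<and> n = 0 \<and> m = 0 \<and> l = 0" by auto
    then show "v = 0" using cancel(3,4)[OF p] by (simp add: m_def n_def l_def vec_eq_iff forall_4)
  qed
  then have "fundamental_system bf (\<lambda>p. \<alpha> * (iX p * iX p)) cf (\<lambda>p. \<beta> * (iY p * iY p)) U ?w"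
    using system[of \<alpha> \<beta>] monomial_solves(1)[OF \<alpha> \<beta>]
    by (simp add: fundamental_system_def fundamental_system_axioms_def)
  then show thesis using that \<beta>0 by blast
qed

lemma dim_family_solutions: "vector_space.dim fscale (family_solutions k1 k2 k3 U) = 4"
proof -
  obtain e where "fundamental_system bf (\<lambda>_. 0) cf (\<lambda>_. 0) U e" by (rule family_fundamental_system)
  then interpret fundamental_system bf "\<lambda>_. 0" cf "\<lambda>_. 0" U e .
  obtain p where p: "p \<in> U" using nonempty_U by blast
  show ?thesis
    unfolding family_solutions_def
    by (rule dim_eq_4_of_basis4[OF basis_of_wronskian_nonzero[OF solutions p wronskian_nonzero[OF p]]])
qed

lemma fundamental_system_of_basis:
  assumes "is_basis4 z (family_solutions k1 k2 k3 U)"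
  shows "fundamental_system bf (\<lambda>_. 0) cf (\<lambda>_. 0) U z"
proof -
  interpret linear_system bf "\<lambda>_. 0" cf "\<lambda>_. 0" U using system[of 0 0] by simp
  have b: "is_basis4 z (solution_space bf (\<lambda>_. 0) cf (\<lambda>_. 0) U)"
    using assms by (simp add: family_solutions_def)
  show ?thesis
    using basis4_mem[OF b] wronskian_basis_nonzero[OF b] linear_system_axioms
    by (simp add: fundamental_system_def fundamental_system_axioms_def mem_solution_space_iff)
qed

lemma projectively_applicable_of_basis:
  assumes z: "is_basis4 z (family_solutions k1 k2 k3 U)"
  shows "projectively_applicable U (map_of_functions z)"
proof -
  interpret z: fundamental_system bf "\<lambda>_. 0" cf "\<lambda>_. 0" U z
    by (rule fundamental_system_of_basis[OF z])
  obtain p where p: "p \<in> U" using nonempty_U by blast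
  obtain \<alpha> \<beta> w0 where \<beta>: "\<beta> \<noteq> 0"
    and w0: "fundamental_system bf (\<lambda>p. \<alpha> * (iX p * iX p)) cf (\<lambda>p. \<beta> * (iY p * iY p)) U w0"
    by (rule deformed_fundamental_system)
  define s where "s = det (wronskian z p) / det (wronskian w0 p)"
  have w0p: "det (wronskian w0 p) \<noteq> 0" by (rule fundamental_system.wronskian_nonzero[OF w0 p])
  then have s: "s \<noteq> 0" using z.wronskian_nonzero[OF p] by (simp add: s_def)
  obtain w where w: "fundamental_system bf (\<lambda>p. \<alpha> * (iX p * iX p)) cf (\<lambda>p. \<beta> * (iY p * iY p)) U w"
    and ws: "\<And>p. p \<in> U \<Longrightarrow> det (wronskian w p) = s * det (wronskian w0 p)"
    by (rule fundamental_system_rescale[OF w0 s]) (rule that)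
  interpret w: fundamental_system bf "\<lambda>p. \<alpha> * (iX p * iX p)" cf "\<lambda>p. \<beta> * (iY p * iY p)" U w by (rule w)
  have "det (wronskian z q) = det (wronskian w q)" if q: "q \<in> U" for q
    using z.det_wronskian_constant[OF z.solutions p q] w.det_wronskian_constant[OF w.solutions p q] ws[OF p] w0p
    by (simp add: s_def)
  then have "projective_deformation U (map_of_functions z) U (map_of_functions w) (\<lambda>p. p)"
    by (rule projective_deformation_of_same_bc[OF z.fundamental_system_axioms w])
  moreover have "\<not> trivial_deformation U (map_of_functions z) (map_of_functions w) (\<lambda>p. p)"
  proof
    assume triv: "trivial_deformation U (map_of_functions z) (map_of_functions w) (\<lambda>p. p)"
    have "solves bf (\<lambda>_. 0) cf (\<lambda>_. 0) U (monomial 0 0)" by (rule monomial_solves_family) auto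
    then have "solves bf (\<lambda>_. 0) cf (\<lambda>_. 0) U (\<lambda>q. if q \<in> U then 1 else 0)"
      by (rule z.solves_cong) (simp add: monomial_def)
    then have "(\<lambda>q. if q \<in> U then 1 else 0) \<in> family_solutions k1 k2 k3 U"
      by (simp add: family_solutions_def mem_solution_space_iff)
    then obtain a where a: "(\<lambda>q. if q \<in> U then 1 else 0) = lincomb a z"
      using basis4_span[OF z] by blast
    have "lincomb a z q = 1" if "q \<in> U" for q using that by (simp flip: a)
    from trivial_deformation_potentials_vanish[OF z.fundamental_system_axioms w this triv p]
    show False using \<beta> cancel(4)[OF p] by simp
  qed
  ultimately show ?thesis
    unfolding projectively_applicable_def using z.immersed[OF nonempty_U] w.immersed[OF nonempty_U] by blast
qed

theorem family_properties:
  "vector_space.dim fscale (family_solutions k1 k2 k3 U) = 4 \<and>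
     (\<forall>z. is_basis4 z (family_solutions k1 k2 k3 U) \<longrightarrow>
        immersed_surface U (map_of_functions z) \<and>
        second_ff_conformal_dxdy U (map_of_functions z) \<and>
        asymptotic_coordinates U (map_of_functions z) \<and>
        projectively_applicable U (map_of_functions z))"
  using dim_family_solutions projectively_applicable_of_basis
    fundamental_system.immersed[OF fundamental_system_of_basis nonempty_U]
    fundamental_system.conformal[OF fundamental_system_of_basis]
    fundamental_system.asymptotic[OF fundamental_system_of_basis] by blast

end

section \<open>The real and the complex case\<close>

lemma real_primitive_inverse_affine:
  fixes a b :: real
  obtains F where "\<And>t. a * t + b \<noteq> 0 \<Longrightarrow> (F has_field_derivative inverse (a * t + b)) (at t)"
proof (cases "a = 0")
  case True
  show thesis
    by (rule that[of "\<lambda>t. t / b"]) (use True in \<open>auto intro!: derivative_eq_intros simp: divide_inverse\<close>)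
next
  case False
  have ln: "(ln has_field_derivative inverse u) (at u)" if "u \<noteq> 0" for u :: real
  proof (cases "u > 0")
    case False
    then have "((\<lambda>u. ln (- u)) has_field_derivative inverse (- u) * - 1) (at u)"
      using that by (intro DERIV_chain2[OF DERIV_ln]) (auto intro!: derivative_eq_intros)
    then show ?thesis by (simp add: ln_minus)
  qed (rule DERIV_ln)
  show thesis
  proof (rule that[of "\<lambda>t. ln (a * t + b) / a"])
    fix t assume t: "a * t + b \<noteq> 0"
    have "((\<lambda>t. a * t + b) has_field_derivative a) (at t)"
      by (auto intro!: derivative_eq_intros)
    from DERIV_cdivide[OF DERIV_chain2[OF ln[OF t] this], of a]
    show "((\<lambda>t. ln (a * t + b) / a) has_field_derivative inverse (a * t + b)) (at t)"
      using False by simp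
  qed
qed

lemma complex_primitive_inverse_affine:
  fixes a b :: complex
  assumes "open S" "convex S" "\<And>t. t \<in> S \<Longrightarrow> a * t + b \<noteq> 0"
  obtains F where "\<And>t. t \<in> S \<Longrightarrow> (F has_field_derivative inverse (a * t + b)) (at t)"
proof -
  have "(\<lambda>t. inverse (a * t + b)) holomorphic_on S"
    using assms(3) by (intro holomorphic_intros) auto
  then obtain F where "\<And>t. t \<in> S \<Longrightarrow> (F has_field_derivative inverse (a * t + b)) (at t within S)"
    using holomorphic_convex_primitive'[OF assms(2,1)] by blast
  then show thesis using that[of F] by (simp add: at_within_open[OF _ assms(1)])
qed

theorem proposition5p5:
  shows "(\<forall>(k1::real) k2 k3 U.
           open U \<and> convex U \<and> U \<noteq> {} \<and> U \<subseteq> coeff_domain k1 k2 k3 \<longrightarrow>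
             vector_space.dim fscale (family_solutions k1 k2 k3 U) = 4 \<and>
             (\<forall>z. is_basis4 z (family_solutions k1 k2 k3 U) \<longrightarrow>
                immersed_surface U (map_of_functions z) \<and>
                second_ff_conformal_dxdy U (map_of_functions z) \<and>
                asymptotic_coordinates U (map_of_functions z) \<and>
                projectively_applicable U (map_of_functions z))) \<and>
         (\<forall>(k1::complex) k2 k3 U.
           open U \<and> convex U \<and> U \<noteq> {} \<and> U \<subseteq> coeff_domain k1 k2 k3 \<longrightarrow>
             vector_space.dim fscale (family_solutions k1 k2 k3 U) = 4 \<and>
             (\<forall>z. is_basis4 z (family_solutions k1 k2 k3 U) \<longrightarrow>
                immersed_surface U (map_of_functions z) \<and>
                second_ff_conformal_dxdy U (map_of_functions z) \<and>
                asymptotic_coordinates U (map_of_functions z) \<and>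
                projectively_applicable U (map_of_functions z)))"
proof (intro conjI[of "\<forall>k1 :: real. _ k1"] allI impI)
  fix k1 k2 k3 :: real and U
  assume U: "open U \<and> convex U \<and> U \<noteq> {} \<and> U \<subseteq> coeff_domain k1 k2 k3"
  obtain A where A: "\<And>t. 4 * t + k3 \<noteq> 0 \<Longrightarrow> (A has_field_derivative inverse (4 * t + k3)) (at t)"
    using real_primitive_inverse_affine by blast
  obtain B where B: "\<And>t. k1 * t + k2 \<noteq> 0 \<Longrightarrow> (B has_field_derivative inverse (k1 * t + k2)) (at t)"
    using real_primitive_inverse_affine by blast
  have "family k1 k2 k3 U A B"
    by unfold_locales (use U A B in \<open>auto simp: coeff_domain_def\<close>)
  then show "vector_space.dim fscale (family_solutions k1 k2 k3 U) = 4 \<and>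
             (\<forall>z. is_basis4 z (family_solutions k1 k2 k3 U) \<longrightarrow>
                immersed_surface U (map_of_functions z) \<and>
                second_ff_conformal_dxdy U (map_of_functions z) \<and>
                asymptotic_coordinates U (map_of_functions z) \<and>
                projectively_applicable U (map_of_functions z))"
    by (rule family.family_properties)
next
  fix k1 k2 k3 :: complex and U
  assume U: "open U \<and> convex U \<and> U \<noteq> {} \<and> U \<subseteq> coeff_domain k1 k2 k3"
  have "open (fst ` U)" "open (snd ` U)" using U by (auto intro: open_image_fst open_image_snd)
  moreover have "convex (fst ` U)" "convex (snd ` U)"
    using U by (auto intro: convex_linear_image linear_fst linear_snd)
  moreover have "4 * t + k3 \<noteq> 0" if "t \<in> fst ` U" for t
    using that U by (auto simp: coeff_domain_def)
  moreover have "k1 * t + k2 \<noteq> 0" if "t \<in> snd ` U" for t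
    using that U by (auto simp: coeff_domain_def)
  ultimately obtain A B where A: "\<And>t. t \<in> fst ` U \<Longrightarrow> (A has_field_derivative inverse (4 * t + k3)) (at t)"
    and B: "\<And>t. t \<in> snd ` U \<Longrightarrow> (B has_field_derivative inverse (k1 * t + k2)) (at t)"
    using complex_primitive_inverse_affine[of "fst ` U" 4 k3] complex_primitive_inverse_affine[of "snd ` U" k1 k2]
    by metis
  have "family k1 k2 k3 U A B"
    by unfold_locales (use U A B in auto)
  then show "vector_space.dim fscale (family_solutions k1 k2 k3 U) = 4 \<and>
             (\<forall>z. is_basis4 z (family_solutions k1 k2 k3 U) \<longrightarrow>
                immersed_surface U (map_of_functions z) \<and>
                second_ff_conformal_dxdy U (map_of_functions z) \<and>
                asymptotic_coordinates U (map_of_functions z) \<and>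
                projectively_applicable U (map_of_functions z))"
    by (rule family.family_properties)
qed

end
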